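(* Let $T$ be an integral domain, $M$ a maximal ideal of $T$, $K=T/M$ its residue field, $\phi:T\to K$ the canonical surjection, $D$ a proper subring of $K$, and $R:=\phi^{-1}(D)$. Suppose that $D$ is a semilocal conducive domain whose quotient field is $K$, and that either (a) or (b) holds: (a) $T$ is a valuation domain; (b) $T=K[X]$, with $X$ an indeterminate over $K$, $M=XK[X]$, $\phi$ is evaluation at $X=0$, and $R=D+XK[X]$. Then $R$ is Clifford regular if and only if $D$ is Clifford regular.
   Context: For an integral domain $A$, the class semigroup $\mathcal{S}(A)$ is the commutative multiplicative semigroup of nonzero fractional ideals of $A$ modulo its subsemigroup of nonzero principal fractional ideals. A commutative semigroup $S$ is Clifford if for every $x\in S$ there is $a\in S$ with $x^2a=x$. $A$ is Clifford regular if $\mathcal{S}(A)$ is Clifford. An overring of $A$ is a ring between $A$ and its quotient field. $A$ is conducive if the conductor $(A:B)=\{x\in \mathrm{Frac}(A): xB\subseteq A\}$ is nonzero for each overring $B$ of $A$ other than its quotient field. Semilocal means having only finitely many maximal ideals (not necessarily Noetherian). *)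

theory Defs
  imports "HOL-Algebra.Algebra"
begin

text \<open>
  HOL-Algebra has no quotient fields. An integral domain is therefore given as a subring \<open>A\<close>
  of a field \<open>F\<close>, and its quotient field is formed inside \<open>F\<close>. The field \<open>F\<close> may be larger
  than the quotient field of \<open>A\<close>.
\<close>

definition quotient_field :: "('a, 'm) ring_scheme \<Rightarrow> 'a set \<Rightarrow> 'a set" where
  "quotient_field F A = {a \<otimes>\<^bsub>F\<^esub> inv\<^bsub>F\<^esub> b | a b. a \<in> A \<and> b \<in> A \<and> b \<noteq> \<zero>\<^bsub>F\<^esub>}"

definition nonzero_fractional_ideals :: "('a, 'm) ring_scheme \<Rightarrow> 'a set \<Rightarrow> 'a set set" where
  "nonzero_fractional_ideals F A =
     {I. I \<subseteq> quotient_field F A \<and> additive_subgroup I F \<and>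
         (\<forall>a\<in>A. \<forall>x\<in>I. a \<otimes>\<^bsub>F\<^esub> x \<in> I) \<and>
         (\<exists>d\<in>A. d \<noteq> \<zero>\<^bsub>F\<^esub> \<and> (\<forall>x\<in>I. d \<otimes>\<^bsub>F\<^esub> x \<in> A)) \<and>
         I \<noteq> {\<zero>\<^bsub>F\<^esub>}}"

definition nonzero_principal_fractional_ideals :: "('a, 'm) ring_scheme \<Rightarrow> 'a set \<Rightarrow> 'a set set" where
  "nonzero_principal_fractional_ideals F A =
     {x <#\<^bsub>F\<^esub> A | x. x \<in> quotient_field F A \<and> x \<noteq> \<zero>\<^bsub>F\<^esub>}"

text \<open>
  The congruence \<open>I P = J Q\<close> with \<open>P\<close>, \<open>Q\<close> nonzero principal. The library's \<^const>\<open>ideal_prod\<close>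
  makes sense for arbitrary subsets of \<open>F\<close>: it is the set of nonempty finite sums of products.
\<close>

definition class_rel :: "('a, 'm) ring_scheme \<Rightarrow> 'a set \<Rightarrow> ('a set \<times> 'a set) set" where
  "class_rel F A =
     {(I, J). I \<in> nonzero_fractional_ideals F A \<and> J \<in> nonzero_fractional_ideals F A \<and>
        (\<exists>P\<in>nonzero_principal_fractional_ideals F A.
         \<exists>Q\<in>nonzero_principal_fractional_ideals F A. I \<cdot>\<^bsub>F\<^esub> P = J \<cdot>\<^bsub>F\<^esub> Q)}"

text \<open>
  The product of two classes is the class of \<open>I J\<close> for any representatives \<open>I\<close>, \<open>J\<close>, written as the
  union over all choices of representatives. The unit is the class of \<open>A\<close>.
\<close>

definition class_semigroup :: "('a, 'm) ring_scheme \<Rightarrow> 'a set \<Rightarrow> 'a set set monoid" where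
  "class_semigroup F A =
     \<lparr> carrier = nonzero_fractional_ideals F A // class_rel F A,
       monoid.mult = (\<lambda>\<I> \<J>. \<Union>I\<in>\<I>. \<Union>J\<in>\<J>. class_rel F A `` {I \<cdot>\<^bsub>F\<^esub> J}),
       monoid.one = class_rel F A `` {A} \<rparr>"

definition clifford_semigroup :: "('a, 'm) monoid_scheme \<Rightarrow> bool" where
  "clifford_semigroup S \<longleftrightarrow>
     (\<forall>x\<in>carrier S. \<exists>a\<in>carrier S. (x \<otimes>\<^bsub>S\<^esub> x) \<otimes>\<^bsub>S\<^esub> a = x)"

definition clifford_regular :: "('a, 'm) ring_scheme \<Rightarrow> 'a set \<Rightarrow> bool" where
  "clifford_regular F A \<longleftrightarrow> clifford_semigroup (class_semigroup F A)"

definition overring :: "('a, 'm) ring_scheme \<Rightarrow> 'a set \<Rightarrow> 'a set \<Rightarrow> bool" where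
  "overring F A B \<longleftrightarrow> subring B F \<and> A \<subseteq> B \<and> B \<subseteq> quotient_field F A"

definition conductor :: "('a, 'm) ring_scheme \<Rightarrow> 'a set \<Rightarrow> 'a set \<Rightarrow> 'a set" where
  "conductor F A B = {x \<in> quotient_field F A. \<forall>b\<in>B. x \<otimes>\<^bsub>F\<^esub> b \<in> A}"

definition conducive :: "('a, 'm) ring_scheme \<Rightarrow> 'a set \<Rightarrow> bool" where
  "conducive F A \<longleftrightarrow>
     (\<forall>B. overring F A B \<and> B \<noteq> quotient_field F A \<longrightarrow> conductor F A B \<noteq> {\<zero>\<^bsub>F\<^esub>})"

definition semilocal :: "('a, 'm) ring_scheme \<Rightarrow> bool" where
  "semilocal A \<longleftrightarrow> finite {P. maximalideal P A}"

definition valuation_domain :: "('a, 'm) ring_scheme \<Rightarrow> 'a set \<Rightarrow> bool" where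
  "valuation_domain F A \<longleftrightarrow>
     (\<forall>x\<in>quotient_field F A. x \<noteq> \<zero>\<^bsub>F\<^esub> \<longrightarrow> x \<in> A \<or> inv\<^bsub>F\<^esub> x \<in> A)"

end

theory Submission
  imports Defs
begin

text \<open>
  Let \<open>M\<close> be the kernel of \<open>\<phi>\<close>, so that \<open>K = T / M\<close>. It is an ideal of \<open>T\<close> contained in \<open>R\<close>.
  For a \<open>D\<close>-submodule \<open>J\<close> of \<open>K\<close> write \<open>\<phi>\<inverse>(J)\<close> for its preimage in \<open>T\<close>. The whole proof rests on one
  computation: if \<open>I\<close> is nonzero, then \<open>\<phi>\<inverse>(I) \<phi>\<inverse>(J) = \<phi>\<inverse>(I J)\<close> (\<open>preimage_prod\<close>). Both sides have
  the same image in \<open>K\<close>, and the left side contains \<open>M\<close> because \<open>\<phi>\<inverse>(I)\<close> contains an element that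
  is invertible modulo \<open>M\<close>.

  Clifford regularity of a domain \<open>A\<close> means that every nonzero fractional ideal \<open>I\<close> satisfies
  \<open>I I J = I\<close> for some fractional ideal \<open>J\<close> (\<open>clifford_regular_iff\<close>); this property does not change
  when \<open>I\<close> is multiplied by a nonzero element of the quotient field.

  If \<open>R\<close> is Clifford regular, scale a fractional ideal \<open>J\<close> of \<open>D\<close> so that \<open>1 \<in> J\<close>. An equation
  \<open>I I I' = I\<close> for \<open>I = \<phi>\<inverse>(J)\<close> forces \<open>I' \<subseteq> I \<subseteq> T\<close>, so it can be mapped to \<open>K\<close>, where it becomes
  \<open>J J \<phi>(I') = J\<close> (\<open>clifford_regular_residue\<close>).

  Conversely let \<open>D\<close> be Clifford regular and \<open>I\<close> a fractional ideal of \<open>R\<close>. Suppose that some multiple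
  \<open>z I\<close> lies between \<open>M\<close> and \<open>T\<close> and is not contained in \<open>M\<close>. Then \<open>z I = \<phi>\<inverse>(J)\<close> with \<open>J = \<phi>(z I)\<close>.
  Either \<open>J = K\<close>, and \<open>J J J = J\<close>, or \<open>J\<close> is a proper \<open>D\<close>-submodule of \<open>K\<close>. Since \<open>D\<close> is conducive,
  such a \<open>J\<close> is a fractional ideal of \<open>D\<close> (\<open>conducive_submod_denominator\<close>), so \<open>J J J' = J\<close> for some
  \<open>J'\<close>, and \<open>preimage_prod\<close> lifts this equation to \<open>R\<close> (\<open>vn_regular_between\<close>).

  It remains to find \<open>z\<close>. In \<open>K[X]\<close>, and in any principal ideal domain \<open>T\<close>, the \<open>T\<close>-module \<open>T I\<close> is
  generated by one element, so \<open>I\<close> can be scaled to \<open>T I = T\<close>; then \<open>M = M T I = M I \<subseteq> I \<subseteq> T\<close>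
  (\<open>clifford_regular_principal\<close>). If \<open>T\<close> is a valuation domain and \<open>I\<close> is not a \<open>T\<close>-module, say
  \<open>x \<in> I\<close> and \<open>v x \<notin> I\<close> with \<open>v \<in> T\<close>, then \<open>z = 1 / x\<close> works; and fractional ideals that are modules
  over a valuation domain are always regular (\<open>clifford_regular_valuation\<close>, \<open>valuation_vn_regular\<close>).
\<close>

section \<open>Modules over a subring of a field\<close>

(* The multiset relation competes with the notation for cosets. *)
no_notation subset_mset (infix \<open><#\<close> 50)

definition submod :: "('a, 'm) ring_scheme \<Rightarrow> 'a set \<Rightarrow> 'a set \<Rightarrow> bool" where
  "submod F A I \<longleftrightarrow> additive_subgroup I F \<and> (\<forall>a\<in>A. \<forall>x\<in>I. a \<otimes>\<^bsub>F\<^esub> x \<in> I)"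

lemma submodD:
  assumes "submod F A I"
  shows "I \<subseteq> carrier F" "\<zero>\<^bsub>F\<^esub> \<in> I"
    and "\<And>x y. x \<in> I \<Longrightarrow> y \<in> I \<Longrightarrow> x \<oplus>\<^bsub>F\<^esub> y \<in> I"
    and "\<And>x. x \<in> I \<Longrightarrow> \<ominus>\<^bsub>F\<^esub> x \<in> I"
    and "\<And>a x. a \<in> A \<Longrightarrow> x \<in> I \<Longrightarrow> a \<otimes>\<^bsub>F\<^esub> x \<in> I"
  using assms unfolding submod_def
  by (auto dest: additive_subgroup.a_subset additive_subgroup.zero_closed
      additive_subgroup.a_closed additive_subgroup.a_inv_closed)

lemma (in ring) submodI:
  assumes "I \<subseteq> carrier R" "\<zero> \<in> I"
    and "\<And>x y. x \<in> I \<Longrightarrow> y \<in> I \<Longrightarrow> x \<oplus> y \<in> I"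
    and "\<And>x. x \<in> I \<Longrightarrow> \<ominus> x \<in> I"
    and "\<And>a x. a \<in> A \<Longrightarrow> x \<in> I \<Longrightarrow> a \<otimes> x \<in> I"
  shows "submod R A I"
  unfolding submod_def
  using assms by (auto intro!: additive_subgroupI add.subgroupI simp: a_inv_def)

lemma submod_mono: "submod F B I \<Longrightarrow> A \<subseteq> B \<Longrightarrow> submod F A I"
  by (auto simp: submod_def)

lemma (in ring) subring_submod: "subring A R \<Longrightarrow> submod R A A"
  by (intro submodI) (auto dest: subringE)

lemma mem_l_coset: "y \<in> x <#\<^bsub>F\<^esub> I \<longleftrightarrow> (\<exists>i\<in>I. y = x \<otimes>\<^bsub>F\<^esub> i)"
  by (auto simp: l_coset_def)

context field
begin

lemma nonzero_inv:
  assumes "x \<in> carrier R" "x \<noteq> \<zero>"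
  shows "inv x \<in> carrier R" "inv x \<noteq> \<zero>" "x \<otimes> inv x = \<one>" "inv x \<otimes> x = \<one>"
proof -
  have u: "x \<in> Units R" using assms by (simp add: field_Units)
  show "inv x \<in> carrier R" "x \<otimes> inv x = \<one>" "inv x \<otimes> x = \<one>"
    using u by auto
  then show "inv x \<noteq> \<zero>" using assms by auto
qed

lemma inv_cancel:
  assumes "x \<in> carrier R" "x \<noteq> \<zero>" "y \<in> carrier R"
  shows "x \<otimes> (inv x \<otimes> y) = y" "inv x \<otimes> (x \<otimes> y) = y"
  using assms nonzero_inv[of x] by (simp_all add: m_assoc[symmetric])

lemma nonzero_inv_inv: "x \<in> carrier R \<Longrightarrow> x \<noteq> \<zero> \<Longrightarrow> inv (inv x) = x"
  by (simp add: field_Units)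

lemma nonzero_inv_mult:
  assumes "x \<in> carrier R" "x \<noteq> \<zero>" "y \<in> carrier R" "y \<noteq> \<zero>"
  shows "inv (x \<otimes> y) = inv x \<otimes> inv y"
proof (rule comm_inv_char)
  show "x \<otimes> y \<otimes> (inv x \<otimes> inv y) = \<one>"
    using assms nonzero_inv[of x] nonzero_inv[of y] by (simp add: m_ac inv_cancel)
qed (use assms nonzero_inv in auto)

lemma l_coset_l_coset:
  assumes "x \<in> carrier R" "y \<in> carrier R" "I \<subseteq> carrier R"
  shows "x <# (y <# I) = (x \<otimes> y) <# I"
  using assms by (force simp: mem_l_coset m_assoc)

lemma one_l_coset: "I \<subseteq> carrier R \<Longrightarrow> \<one> <# I = I"
  by (force simp: mem_l_coset)

lemma inv_l_coset:
  assumes "x \<in> carrier R" "x \<noteq> \<zero>" "I \<subseteq> carrier R"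
  shows "inv x <# (x <# I) = I" "x <# (inv x <# I) = I"
  using assms nonzero_inv[of x] by (simp_all add: l_coset_l_coset one_l_coset)

lemma l_coset_in_carrier: "x \<in> carrier R \<Longrightarrow> I \<subseteq> carrier R \<Longrightarrow> x <# I \<subseteq> carrier R"
  by (force simp: mem_l_coset)

lemma submod_l_coset:
  assumes "submod R A I" "x \<in> carrier R" "A \<subseteq> carrier R"
  shows "submod R A (x <# I)"
proof -
  note I = submodD[OF assms(1)]
  show ?thesis
  proof (rule submodI)
    show "x <# I \<subseteq> carrier R" using l_coset_in_carrier assms I by blast
    show "\<zero> \<in> x <# I" unfolding mem_l_coset using assms I by (intro bexI[of _ \<zero>]) auto
    show "u \<oplus> v \<in> x <# I" if uv: "u \<in> x <# I" "v \<in> x <# I" for u v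
    proof -
      obtain a b where "a \<in> I" "b \<in> I" "u = x \<otimes> a" "v = x \<otimes> b"
        using uv unfolding mem_l_coset by blast
      then show ?thesis unfolding mem_l_coset using assms I
        by (intro bexI[of _ "a \<oplus> b"]) (auto simp: r_distr subset_iff)
    qed
    show "\<ominus> u \<in> x <# I" if uv: "u \<in> x <# I" for u
    proof -
      obtain a where "a \<in> I" "u = x \<otimes> a"
        using uv unfolding mem_l_coset by blast
      then show ?thesis unfolding mem_l_coset using assms I
        by (intro bexI[of _ "\<ominus> a"]) (auto simp: r_minus subset_iff)
    qed
    show "c \<otimes> u \<in> x <# I" if uv: "c \<in> A" "u \<in> x <# I" for u c
    proof -
      obtain a where "a \<in> I" "u = x \<otimes> a"
        using uv unfolding mem_l_coset by blast
      then show ?thesis unfolding mem_l_coset using assms I uv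
        by (intro bexI[of _ "c \<otimes> a"]) (auto simp: m_lcomm subset_iff)
    qed
  qed
qed

end

section \<open>Products of subsets of a field\<close>

context field
begin
lemma prod_in_carrier:
  assumes "I \<subseteq> carrier R" "J \<subseteq> carrier R"
  shows "I \<cdot> J \<subseteq> carrier R"
proof
  fix x assume "x \<in> I \<cdot> J"
  then show "x \<in> carrier R" by induction (use assms in auto)
qed

lemma prod_least:
  assumes "\<And>i j. i \<in> I \<Longrightarrow> j \<in> J \<Longrightarrow> i \<otimes> j \<in> S"
    and "\<And>x y. x \<in> S \<Longrightarrow> y \<in> S \<Longrightarrow> x \<oplus> y \<in> S"
  shows "I \<cdot> J \<subseteq> S"
proof
  fix x assume "x \<in> I \<cdot> J"
  then show "x \<in> S" by induction (use assms in auto)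
qed

lemma prod_comm:
  assumes "I \<subseteq> carrier R" "J \<subseteq> carrier R"
  shows "I \<cdot> J = J \<cdot> I"
proof -
  have *: "I \<cdot> J \<subseteq> J \<cdot> I" if "I \<subseteq> carrier R" "J \<subseteq> carrier R" for I J
  proof (rule prod_least)
    show "i \<otimes> j \<in> J \<cdot> I" if "i \<in> I" "j \<in> J" for i j
      using that \<open>I \<subseteq> _\<close> \<open>J \<subseteq> _\<close> ideal_prod.prod[of j J i I R] by (auto simp: m_comm subset_iff)
  qed (rule ideal_prod.sum)
  show ?thesis using *[of I J] *[of J I] assms by blast
qed

text \<open>
  Products of arbitrary subsets are associative, because \<^const>\<open>ideal_prod\<close> is generated by sums as
  well as products. One inclusion suffices: the other follows from it by commutativity.
\<close>

lemma prod_assoc: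
  assumes "I \<subseteq> carrier R" "J \<subseteq> carrier R" "H \<subseteq> carrier R"
  shows "I \<cdot> J \<cdot> H = I \<cdot> (J \<cdot> H)"
proof -
  have *: "I \<cdot> J \<cdot> H \<subseteq> I \<cdot> (J \<cdot> H)"
    if c: "I \<subseteq> carrier R" "J \<subseteq> carrier R" "H \<subseteq> carrier R" for I J H
  proof (rule prod_least)
    fix s h assume "s \<in> I \<cdot> J" and h: "h \<in> H"
    from this(1) show "s \<otimes> h \<in> I \<cdot> (J \<cdot> H)"
    proof induction
      case (prod i j)
      then show ?case using h c by (auto simp: m_assoc subset_iff intro!: ideal_prod.prod)
    next
      case (sum s t)
      then have "s \<in> carrier R" "t \<in> carrier R" using prod_in_carrier c by blast+
      with sum show ?case using h c by (auto simp: l_distr subset_iff intro!: ideal_prod.sum)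
    qed
  qed (rule ideal_prod.sum)
  have "I \<cdot> (J \<cdot> H) = H \<cdot> J \<cdot> I"
    using assms prod_in_carrier by (metis prod_comm)
  also have "\<dots> \<subseteq> H \<cdot> (J \<cdot> I)" using * assms by blast
  also have "\<dots> = I \<cdot> J \<cdot> H"
    using assms prod_in_carrier by (metis prod_comm)
  finally show ?thesis using *[OF assms] by blast
qed

lemma prod_l_coset:
  assumes "x \<in> carrier R" "I \<subseteq> carrier R" "J \<subseteq> carrier R"
  shows "(x <# I) \<cdot> J = x <# (I \<cdot> J)"
proof
  show "(x <# I) \<cdot> J \<subseteq> x <# (I \<cdot> J)"
  proof (rule prod_least)
    fix u j assume "u \<in> x <# I" and j: "j \<in> J"
    then obtain i where i: "i \<in> I" "u = x \<otimes> i" unfolding mem_l_coset by blast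
    then show "u \<otimes> j \<in> x <# (I \<cdot> J)" unfolding mem_l_coset using assms j
      by (intro bexI[of _ "i \<otimes> j"]) (auto simp: m_assoc subset_iff intro: ideal_prod.prod)
  next
    fix u v assume "u \<in> x <# (I \<cdot> J)" "v \<in> x <# (I \<cdot> J)"
    then obtain a b where ab: "a \<in> I \<cdot> J" "b \<in> I \<cdot> J" "u = x \<otimes> a" "v = x \<otimes> b"
      unfolding mem_l_coset by blast
    moreover have "a \<in> carrier R" "b \<in> carrier R" using ab prod_in_carrier assms by blast+
    ultimately show "u \<oplus> v \<in> x <# (I \<cdot> J)" unfolding mem_l_coset using assms
      by (intro bexI[of _ "a \<oplus> b"]) (auto simp: r_distr intro: ideal_prod.sum)
  qed
  show "x <# (I \<cdot> J) \<subseteq> (x <# I) \<cdot> J"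
  proof
    fix u assume "u \<in> x <# (I \<cdot> J)"
    then obtain a where a: "a \<in> I \<cdot> J" "u = x \<otimes> a" unfolding mem_l_coset by blast
    from a(1) have "x \<otimes> a \<in> (x <# I) \<cdot> J"
    proof induction
      case (prod i j)
      then have "x \<otimes> (i \<otimes> j) = (x \<otimes> i) \<otimes> j" using assms by (auto simp: m_assoc subset_iff)
      moreover have "x \<otimes> i \<in> x <# I" using prod by (auto simp: mem_l_coset)
      ultimately show ?case using prod by (simp add: ideal_prod.prod)
    next
      case (sum s t)
      then have "s \<in> carrier R" "t \<in> carrier R" using prod_in_carrier assms by blast+
      with sum show ?case using assms by (simp add: r_distr ideal_prod.sum)
    qed
    then show "u \<in> (x <# I) \<cdot> J" using a by simp
  qed
qed

lemma prod_l_coset_l_coset: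
  assumes "x \<in> carrier R" "y \<in> carrier R" "I \<subseteq> carrier R" "J \<subseteq> carrier R"
  shows "(x <# I) \<cdot> (y <# J) = (x \<otimes> y) <# (I \<cdot> J)"
proof -
  have "(x <# I) \<cdot> (y <# J) = x <# (I \<cdot> (y <# J))"
    using assms by (intro prod_l_coset l_coset_in_carrier)
  also have "I \<cdot> (y <# J) = (y <# J) \<cdot> I"
    using assms by (intro prod_comm l_coset_in_carrier)
  also have "\<dots> = y <# (J \<cdot> I)" using assms by (intro prod_l_coset)
  also have "J \<cdot> I = I \<cdot> J" using assms by (intro prod_comm)
  finally show ?thesis using assms by (simp add: l_coset_l_coset prod_in_carrier)
qed

lemma prod_absorb:
  assumes "submod R A I" "\<one> \<in> A" "A \<subseteq> carrier R"
  shows "I \<cdot> A = I"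
proof
  note I = submodD[OF assms(1)]
  have "A \<cdot> I \<subseteq> I" by (rule prod_least) (use I in auto)
  then show "I \<cdot> A \<subseteq> I" using prod_comm[of I A] I assms by simp
  show "I \<subseteq> I \<cdot> A"
  proof
    fix x assume x: "x \<in> I"
    then have "x \<otimes> \<one> \<in> I \<cdot> A" using assms by (intro ideal_prod.prod)
    then show "x \<in> I \<cdot> A" using x I by (auto simp: subset_iff)
  qed
qed

lemma submod_prod:
  assumes "submod R A I" "submod R A J" "A \<subseteq> carrier R"
  shows "submod R A (I \<cdot> J)"
proof -
  note I = submodD[OF assms(1)]
  note J = submodD[OF assms(2)]
  show ?thesis
  proof (rule submodI)
    show "I \<cdot> J \<subseteq> carrier R" using prod_in_carrier I J by blast
    show "\<zero> \<in> I \<cdot> J" using ideal_prod.prod[of \<zero> I \<zero> J R] I J by simp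
    show "u \<oplus> v \<in> I \<cdot> J" if "u \<in> I \<cdot> J" "v \<in> I \<cdot> J" for u v
      using that by (rule ideal_prod.sum)
    show "\<ominus> u \<in> I \<cdot> J" if "u \<in> I \<cdot> J" for u
      using that
    proof induction
      case (prod i j)
      then have "\<ominus> (i \<otimes> j) = (\<ominus> i) \<otimes> j" using I J by (auto simp: l_minus subset_iff)
      then show ?case using prod I by (auto intro: ideal_prod.prod)
    next
      case (sum s t)
      then have "s \<in> carrier R" "t \<in> carrier R" using prod_in_carrier I J by blast+
      with sum show ?case by (auto simp: minus_add intro: ideal_prod.sum)
    qed
    show "c \<otimes> u \<in> I \<cdot> J" if c: "c \<in> A" and "u \<in> I \<cdot> J" for u c
      using that(2)
    proof induction
      case (prod i j)
      then have "c \<otimes> (i \<otimes> j) = (c \<otimes> i) \<otimes> j" using I J c assms by (auto simp: m_assoc subset_iff)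
      then show ?case using prod I c by (auto intro: ideal_prod.prod)
    next
      case (sum s t)
      then have "s \<in> carrier R" "t \<in> carrier R" using prod_in_carrier I J by blast+
      with sum show ?case using c assms by (auto simp: r_distr subset_iff intro: ideal_prod.sum)
    qed
  qed
qed

end

section \<open>Fractional ideals and Clifford regularity\<close>

locale fraction_field = field +
  fixes A
  assumes A: "subring A R" and fractions: "quotient_field R A = carrier R"
begin

abbreviation "fractional_ideals \<equiv> nonzero_fractional_ideals R A"

lemma A_carrier: "A \<subseteq> carrier R" and one_A: "\<one> \<in> A"
  using subringE[OF A] by auto

lemma fraction:
  assumes "x \<in> carrier R"
  obtains a b where "a \<in> A" "b \<in> A" "b \<noteq> \<zero>" "b \<otimes> x = a"
proof -
  obtain a b where ab: "a \<in> A" "b \<in> A" "b \<noteq> \<zero>" "x = a \<otimes> inv b"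
    using assms unfolding fractions[symmetric] quotient_field_def by auto
  moreover have "b \<otimes> x = a"
    using ab A_carrier nonzero_inv[of b] by (auto simp: m_ac subset_iff)
  ultimately show ?thesis using that by blast
qed

lemma fractional_idealD:
  assumes "I \<in> fractional_ideals"
  shows "submod R A I" "I \<subseteq> carrier R"
    and "\<exists>d\<in>A. d \<noteq> \<zero> \<and> (\<forall>x\<in>I. d \<otimes> x \<in> A)"
    and "\<exists>i\<in>I. i \<noteq> \<zero>"
proof -
  show I: "submod R A I" "I \<subseteq> carrier R" "\<exists>d\<in>A. d \<noteq> \<zero> \<and> (\<forall>x\<in>I. d \<otimes> x \<in> A)"
    using assms unfolding nonzero_fractional_ideals_def submod_def
    by (auto dest: additive_subgroup.a_subset)
  have "I \<noteq> {\<zero>}" using assms by (simp add: nonzero_fractional_ideals_def)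
  then show "\<exists>i\<in>I. i \<noteq> \<zero>" using submodD(2)[OF I(1)] by blast
qed

text \<open>
  A denominator \<open>d\<close> may be taken from the quotient field: if \<open>b d = a\<close> with \<open>a\<close>, \<open>b\<close> in \<open>A\<close>, then
  \<open>a\<close> is a denominator in \<open>A\<close>.
\<close>

lemma fractional_idealI:
  assumes "submod R A I" "d \<in> carrier R" "d \<noteq> \<zero>" "\<And>x. x \<in> I \<Longrightarrow> d \<otimes> x \<in> A"
    and "i \<in> I" "i \<noteq> \<zero>"
  shows "I \<in> fractional_ideals"
proof -
  obtain a b where ab: "a \<in> A" "b \<in> A" "b \<noteq> \<zero>" "b \<otimes> d = a"
    using fraction assms by blast
  note I = submodD[OF assms(1)]
  have "a \<noteq> \<zero>" using ab assms A_carrier by (auto simp: integral_iff subset_iff)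
  moreover have "a \<otimes> x \<in> A" if "x \<in> I" for x
  proof -
    have "a \<otimes> x = b \<otimes> (d \<otimes> x)" using ab that assms I A_carrier by (auto simp: m_assoc subset_iff)
    then show ?thesis using ab assms that subringE(6)[OF A] by simp
  qed
  ultimately show ?thesis
    using assms ab I unfolding nonzero_fractional_ideals_def fractions submod_def by auto
qed

lemma fractional_ideal_l_coset:
  assumes "I \<in> fractional_ideals" "z \<in> carrier R" "z \<noteq> \<zero>"
  shows "z <# I \<in> fractional_ideals"
proof -
  note I = fractional_idealD[OF assms(1)]
  obtain d i where d: "d \<in> A" "d \<noteq> \<zero>" "\<forall>x\<in>I. d \<otimes> x \<in> A" and i: "i \<in> I" "i \<noteq> \<zero>"
    using I by blast
  have c: "d \<in> carrier R" "i \<in> carrier R" using d i I A_carrier by auto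
  show ?thesis
  proof (rule fractional_idealI)
    show "submod R A (z <# I)" using submod_l_coset I assms A_carrier by blast
    show "d \<otimes> inv z \<in> carrier R" "d \<otimes> inv z \<noteq> \<zero>"
      using d c assms nonzero_inv[of z] by (auto simp: integral_iff)
    show "z \<otimes> i \<in> z <# I" "z \<otimes> i \<noteq> \<zero>"
      using i c assms by (auto simp: mem_l_coset integral_iff)
    fix x assume "x \<in> z <# I"
    then obtain y where y: "y \<in> I" "x = z \<otimes> y" unfolding mem_l_coset by blast
    then have "d \<otimes> inv z \<otimes> x = d \<otimes> y"
      using c assms I nonzero_inv[of z] by (auto simp: m_assoc inv_cancel subset_iff)
    then show "d \<otimes> inv z \<otimes> x \<in> A" using d y by simp
  qed
qed

lemma fractional_ideal_prod:
  assumes "I \<in> fractional_ideals" "J \<in> fractional_ideals"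
  shows "I \<cdot> J \<in> fractional_ideals"
proof -
  note I = fractional_idealD[OF assms(1)]
  note J = fractional_idealD[OF assms(2)]
  obtain d i where d: "d \<in> A" "d \<noteq> \<zero>" "\<forall>x\<in>I. d \<otimes> x \<in> A" and i: "i \<in> I" "i \<noteq> \<zero>"
    using I by blast
  obtain e j where e: "e \<in> A" "e \<noteq> \<zero>" "\<forall>x\<in>J. e \<otimes> x \<in> A" and j: "j \<in> J" "j \<noteq> \<zero>"
    using J by blast
  have c: "d \<in> carrier R" "i \<in> carrier R" "e \<in> carrier R" "j \<in> carrier R"
    using d e i j I J A_carrier by auto
  show ?thesis
  proof (rule fractional_idealI)
    show "submod R A (I \<cdot> J)" using submod_prod I J A_carrier by blast
    show "d \<otimes> e \<in> carrier R" "d \<otimes> e \<noteq> \<zero>" using c d e by (auto simp: integral_iff)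
    show "i \<otimes> j \<in> I \<cdot> J" "i \<otimes> j \<noteq> \<zero>"
      using i j c by (auto simp: integral_iff intro: ideal_prod.prod)
    have "I \<cdot> J \<subseteq> {x \<in> carrier R. d \<otimes> e \<otimes> x \<in> A}"
    proof (rule prod_least)
      fix x y assume xy: "x \<in> I" "y \<in> J"
      then have "x \<in> carrier R" "y \<in> carrier R" using I J by auto
      moreover from this have "d \<otimes> e \<otimes> (x \<otimes> y) = (d \<otimes> x) \<otimes> (e \<otimes> y)" using c by (simp add: m_ac)
      ultimately show "x \<otimes> y \<in> {x \<in> carrier R. d \<otimes> e \<otimes> x \<in> A}"
        using d e xy subringE(6)[OF A] by simp
    next
      fix x y
      assume "x \<in> {x \<in> carrier R. d \<otimes> e \<otimes> x \<in> A}" "y \<in> {x \<in> carrier R. d \<otimes> e \<otimes> x \<in> A}"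
      then show "x \<oplus> y \<in> {x \<in> carrier R. d \<otimes> e \<otimes> x \<in> A}"
        using c subringE(7)[OF A] by (simp add: r_distr)
    qed
    then show "d \<otimes> e \<otimes> x \<in> A" if "x \<in> I \<cdot> J" for x using that by blast
  qed
qed

lemma prod_principal:
  assumes "I \<in> fractional_ideals" "z \<in> carrier R"
  shows "I \<cdot> (z <# A) = z <# I"
proof -
  note I = fractional_idealD[OF assms(1)]
  have "I \<cdot> (z <# A) = (\<one> <# I) \<cdot> (z <# A)" using I by (simp add: one_l_coset)
  also have "\<dots> = z <# (I \<cdot> A)"
    using prod_l_coset_l_coset[of \<one> z I A] I assms A_carrier by simp
  finally show ?thesis using prod_absorb I one_A A_carrier by simp
qed

text \<open>
  Multiplying \<open>I\<close> by the principal fractional ideal \<open>z A\<close> gives \<open>z I\<close>, so the congruence identifies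
  exactly the ideals that differ by a nonzero factor.
\<close>

lemma class_rel_iff:
  "(I, J) \<in> class_rel R A \<longleftrightarrow>
    I \<in> fractional_ideals \<and> (\<exists>z\<in>carrier R. z \<noteq> \<zero> \<and> J = z <# I)" (is "?l \<longleftrightarrow> ?r")
proof
  assume ?l
  then obtain x y where IJ: "I \<in> fractional_ideals" "J \<in> fractional_ideals"
    and x: "x \<in> carrier R" "x \<noteq> \<zero>" and y: "y \<in> carrier R" "y \<noteq> \<zero>"
    and "I \<cdot> (x <# A) = J \<cdot> (y <# A)"
    unfolding class_rel_def nonzero_principal_fractional_ideals_def fractions by blast
  then have "x <# I = y <# J" by (simp add: prod_principal)
  then have "J = inv y <# (x <# I)"
    using y inv_l_coset(1)[of y J] fractional_idealD(2)[OF IJ(2)] by simp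
  also have "\<dots> = (inv y \<otimes> x) <# I"
    using x y nonzero_inv fractional_idealD(2)[OF IJ(1)] by (simp add: l_coset_l_coset)
  finally show ?r using IJ x y nonzero_inv[of y]
    by (intro conjI bexI[of _ "inv y \<otimes> x"]) (auto simp: integral_iff)
next
  assume ?r
  then obtain z where z: "I \<in> fractional_ideals" "z \<in> carrier R" "z \<noteq> \<zero>" "J = z <# I" by blast
  then have "J \<in> fractional_ideals" using fractional_ideal_l_coset by blast
  moreover from this have "I \<cdot> (z <# A) = J \<cdot> (\<one> <# A)"
    using z fractional_idealD(2)[of J] by (simp add: prod_principal one_l_coset)
  moreover have principal: "x <# A \<in> nonzero_principal_fractional_ideals R A"
    if "x \<in> carrier R" "x \<noteq> \<zero>" for x
    unfolding nonzero_principal_fractional_ideals_def fractions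
    by (rule CollectI, rule exI[of _ x]) (simp add: that)
  ultimately show ?l unfolding class_rel_def using z principal[of z] principal[of \<one>]
    by (simp only: mem_Collect_eq case_prod_conv) (intro conjI bexI, auto)
qed

lemma class_rel_equiv: "equiv fractional_ideals (class_rel R A)"
proof (rule equivI)
  show "class_rel R A \<subseteq> fractional_ideals \<times> fractional_ideals"
    unfolding class_rel_def by auto
  show "refl_on fractional_ideals (class_rel R A)"
    by (rule refl_onI) (auto simp: class_rel_iff one_l_coset fractional_idealD intro!: bexI[of _ \<one>])
  show "sym (class_rel R A)" 
  proof (rule symI)
    fix I J assume "(I, J) \<in> class_rel R A"
    then obtain z where z: "I \<in> fractional_ideals" "z \<in> carrier R" "z \<noteq> \<zero>" "J = z <# I"
      unfolding class_rel_iff by blast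
    then have "J \<in> fractional_ideals" "I = inv z <# J"
      using fractional_ideal_l_coset by (simp_all add: inv_l_coset fractional_idealD)
    then show "(J, I) \<in> class_rel R A"
      unfolding class_rel_iff using z nonzero_inv by blast
  qed
  show "trans (class_rel R A)"
  proof (rule transI)
    fix I J H assume "(I, J) \<in> class_rel R A" "(J, H) \<in> class_rel R A"
    then obtain x y where "I \<in> fractional_ideals" "x \<in> carrier R" "x \<noteq> \<zero>"
      "y \<in> carrier R" "y \<noteq> \<zero>" "H = y <# (x <# I)"
      unfolding class_rel_iff by blast
    then show "(I, H) \<in> class_rel R A" unfolding class_rel_iff
      by (auto simp: l_coset_l_coset fractional_idealD integral_iff intro!: bexI[of _ "y \<otimes> x"])
  qed
qed

lemma class_mult:
  assumes "I \<in> fractional_ideals" "J \<in> fractional_ideals"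
  shows "class_rel R A `` {I} \<otimes>\<^bsub>class_semigroup R A\<^esub> class_rel R A `` {J}
       = class_rel R A `` {I \<cdot> J}"
proof -
  have *: "class_rel R A `` {I' \<cdot> J'} = class_rel R A `` {I \<cdot> J}"
    if I': "I' \<in> class_rel R A `` {I}" and J': "J' \<in> class_rel R A `` {J}" for I' J'
  proof -
    obtain x y where "x \<in> carrier R" "x \<noteq> \<zero>" "I' = x <# I" "y \<in> carrier R" "y \<noteq> \<zero>" "J' = y <# J"
      using I' J' by (auto simp: class_rel_iff)
    then have "(I \<cdot> J, I' \<cdot> J') \<in> class_rel R A"
      unfolding class_rel_iff using assms fractional_ideal_prod
      by (auto simp: prod_l_coset_l_coset fractional_idealD integral_iff intro!: bexI[of _ "x \<otimes> y"])
    then show ?thesis by (metis class_rel_equiv equiv_class_eq)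
  qed
  have "I \<in> class_rel R A `` {I}" "J \<in> class_rel R A `` {J}"
    using assms equiv_class_self[OF class_rel_equiv] by blast+
  then have "(\<Union>I'\<in>class_rel R A `` {I}. \<Union>J'\<in>class_rel R A `` {J}. class_rel R A `` {I' \<cdot> J'})
      = class_rel R A `` {I \<cdot> J}"
    using * by blast
  then show ?thesis by (simp add: class_semigroup_def)
qed

text \<open>
  Von Neumann regularity of \<open>I\<close> itself, not just of its class, in the semigroup of fractional ideals.
\<close>

definition vn_regular where
  "vn_regular I \<longleftrightarrow> (\<exists>J\<in>fractional_ideals. I \<cdot> I \<cdot> J = I)"

text \<open>
  If the class of \<open>J\<close> witnesses the Clifford condition for the class of \<open>I\<close>, then \<open>I = z (I I J)\<close> for
  some nonzero \<open>z\<close>. Replacing \<open>J\<close> by \<open>z J\<close> turns the congruence into an equation of ideals.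
\<close>

theorem clifford_regular_iff:
  "clifford_regular R A \<longleftrightarrow> (\<forall>I\<in>fractional_ideals. vn_regular I)"
proof -
  have carrier: "carrier (class_semigroup R A) = (\<lambda>I. class_rel R A `` {I}) ` fractional_ideals"
    unfolding class_semigroup_def quotient_def by auto
  have mult: "(class_rel R A `` {I} \<otimes>\<^bsub>class_semigroup R A\<^esub> class_rel R A `` {I})
      \<otimes>\<^bsub>class_semigroup R A\<^esub> class_rel R A `` {J} = class_rel R A `` {I \<cdot> I \<cdot> J}"
    if "I \<in> fractional_ideals" "J \<in> fractional_ideals" for I J
    using that fractional_ideal_prod by (simp only: class_mult)
  have "\<exists>J'\<in>fractional_ideals. I \<cdot> I \<cdot> J' = I"
    if I: "I \<in> fractional_ideals" and J: "J \<in> fractional_ideals"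
      and eq: "class_rel R A `` {I \<cdot> I \<cdot> J} = class_rel R A `` {I}" for I J
  proof -
    have "(I \<cdot> I \<cdot> J, I) \<in> class_rel R A"
      using J I fractional_ideal_prod eq_equiv_class[OF eq class_rel_equiv I] by blast
    then obtain z where z: "z \<in> carrier R" "z \<noteq> \<zero>" "I = z <# (I \<cdot> I \<cdot> J)"
      unfolding class_rel_iff by blast
    have "z <# (I \<cdot> I \<cdot> J) = I \<cdot> I \<cdot> (z <# J)"
      using prod_l_coset_l_coset[of \<one> z "I \<cdot> I" J] z I J
      by (simp add: one_l_coset fractional_idealD prod_in_carrier)
    then show ?thesis
      using z J fractional_ideal_l_coset by (metis (no_types))
  qed
  note * = this
  show ?thesis
    unfolding vn_regular_def clifford_regular_def clifford_semigroup_def carrier ball_simps bex_simps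
  proof (intro iffI ballI)
    fix I assume "\<forall>I\<in>fractional_ideals. \<exists>J\<in>fractional_ideals.
      class_rel R A `` {I} \<otimes>\<^bsub>class_semigroup R A\<^esub> class_rel R A `` {I}
      \<otimes>\<^bsub>class_semigroup R A\<^esub> class_rel R A `` {J} = class_rel R A `` {I}"
      and I: "I \<in> fractional_ideals"
    then show "\<exists>J\<in>fractional_ideals. I \<cdot> I \<cdot> J = I" using * mult by metis
  next
    fix I assume "\<forall>I\<in>fractional_ideals. \<exists>J\<in>fractional_ideals. I \<cdot> I \<cdot> J = I"
      and I: "I \<in> fractional_ideals"
    then show "\<exists>J\<in>fractional_ideals.
      class_rel R A `` {I} \<otimes>\<^bsub>class_semigroup R A\<^esub> class_rel R A `` {I}
      \<otimes>\<^bsub>class_semigroup R A\<^esub> class_rel R A `` {J} = class_rel R A `` {I}"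
      using mult by metis
  qed
qed

text \<open>
  From \<open>(z I) (z I) J = z I\<close> it follows that \<open>I I (z J) = I\<close>.
\<close>

lemma vn_regular_l_coset:
  assumes "I \<subseteq> carrier R" "z \<in> carrier R" "z \<noteq> \<zero>" "vn_regular (z <# I)"
  shows "vn_regular I"
proof -
  obtain J where J: "J \<in> fractional_ideals" "(z <# I) \<cdot> (z <# I) \<cdot> J = z <# I"
    using assms unfolding vn_regular_def by blast
  note c = assms fractional_idealD(2)[OF J(1)]
  have "(z <# I) \<cdot> (z <# I) \<cdot> J = (z \<otimes> z) <# (I \<cdot> I \<cdot> J)"
    using c by (simp add: prod_l_coset_l_coset prod_l_coset prod_in_carrier)
  also have "\<dots> = z <# (I \<cdot> I \<cdot> (z <# J))"
    using c prod_l_coset_l_coset[of \<one> z "I \<cdot> I" J]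
    by (simp add: l_coset_l_coset[symmetric] prod_in_carrier one_l_coset)
  finally have "z <# (I \<cdot> I \<cdot> (z <# J)) = z <# I" using J by simp
  then have "I \<cdot> I \<cdot> (z <# J) = I"
    using inv_l_coset(1)[of z] c by (metis prod_in_carrier l_coset_in_carrier)
  then show ?thesis unfolding vn_regular_def
    using J assms fractional_ideal_l_coset by blast
qed

end

section \<open>Valuation overrings and conducive domains\<close>

context field
begin

text \<open>
  The values at \<open>x\<close> of the polynomials over \<open>B\<close> of degree at most \<open>n\<close>. The degree bound is kept
  because the existence of valuation overrings rests on a minimal-degree argument.
\<close>

primrec power_span :: "'a set \<Rightarrow> 'a \<Rightarrow> nat \<Rightarrow> 'a set" where
  "power_span B x 0 = B"
| "power_span B x (Suc n) = {w \<oplus> b \<otimes> x [^] Suc n | w b. w \<in> power_span B x n \<and> b \<in> B}"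

lemma power_span_Suc_cases:
  assumes "y \<in> power_span B x (Suc n)"
  obtains w b where "w \<in> power_span B x n" "b \<in> B" "y = w \<oplus> b \<otimes> x [^] Suc n"
  using assms by (auto simp del: Group.nat_pow_Suc)

lemma power_span_SucI:
  assumes "w \<in> power_span B x n" "b \<in> B" "y = w \<oplus> b \<otimes> x [^] Suc n"
  shows "y \<in> power_span B x (Suc n)"
  using assms by (auto simp del: Group.nat_pow_Suc)

declare power_span.simps(2) [simp del]

lemma power_span_carrier:
  assumes "B \<subseteq> carrier R" "x \<in> carrier R"
  shows "power_span B x n \<subseteq> carrier R"
proof (induction n)
  case 0 then show ?case using assms by simp
next
  case (Suc n)
  show ?case
  proof
    fix y assume "y \<in> power_span B x (Suc n)"
    then show "y \<in> carrier R"
      using Suc assms by (elim power_span_Suc_cases) (auto simp del: Group.nat_pow_Suc)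
  qed
qed

lemma submod_power_span:
  assumes B: "subring B R" and x: "x \<in> carrier R"
  shows "submod R B (power_span B x n)"
proof (induction n)
  case 0 then show ?case using subring_submod[OF B] by simp
next
  case (Suc n)
  note S = submodD[OF Suc]
  have Bc: "B \<subseteq> carrier R" using subringE(1)[OF B] .
  define P where "P = x [^] Suc n"
  have P: "P \<in> carrier R" unfolding P_def using x by (rule nat_pow_closed)
  have cs: thesis
    if "y \<in> power_span B x (Suc n)"
      "\<And>w b. \<lbrakk>w \<in> power_span B x n; b \<in> B; w \<in> carrier R; b \<in> carrier R; y = w \<oplus> b \<otimes> P\<rbrakk> \<Longrightarrow> thesis"
    for y thesis
    by (rule power_span_Suc_cases[OF that(1)], rule that(2)) (use S(1) Bc P_def in auto)
  have in_span: "w \<oplus> b \<otimes> P \<in> power_span B x (Suc n)" if "w \<in> power_span B x n" "b \<in> B" for w b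
    by (rule power_span_SucI[OF that]) (simp only: P_def)
  show ?case
  proof (rule submodI)
    show "power_span B x (Suc n) \<subseteq> carrier R" using power_span_carrier Bc x by blast
    show "\<zero> \<in> power_span B x (Suc n)"
      using in_span[of \<zero> \<zero>] S P subringE(2)[OF B] by simp
    show "y \<oplus> z \<in> power_span B x (Suc n)"
      if y: "y \<in> power_span B x (Suc n)" and z: "z \<in> power_span B x (Suc n)" for y z
    proof -
      from y obtain w b where w: "w \<in> power_span B x n" "b \<in> B" "w \<in> carrier R" "b \<in> carrier R"
        "y = w \<oplus> b \<otimes> P" by (rule cs)
      from z obtain v c where v: "v \<in> power_span B x n" "c \<in> B" "v \<in> carrier R" "c \<in> carrier R"
        "z = v \<oplus> c \<otimes> P" by (rule cs)
      have "y \<oplus> z = (w \<oplus> v) \<oplus> (b \<oplus> c) \<otimes> P" using w v P by (simp add: l_distr a_ac)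
      then show ?thesis using in_span w v S subringE(7)[OF B] by simp
    qed
    show "\<ominus> y \<in> power_span B x (Suc n)" if y: "y \<in> power_span B x (Suc n)" for y
    proof -
      from y obtain w b where w: "w \<in> power_span B x n" "b \<in> B" "w \<in> carrier R" "b \<in> carrier R"
        "y = w \<oplus> b \<otimes> P" by (rule cs)
      have "\<ominus> y = (\<ominus> w) \<oplus> (\<ominus> b) \<otimes> P" using w P by (simp add: minus_add l_minus)
      then show ?thesis using in_span w S subringE(5)[OF B] by simp
    qed
    show "c \<otimes> y \<in> power_span B x (Suc n)" if c: "c \<in> B" and y: "y \<in> power_span B x (Suc n)" for c y
    proof -
      from y obtain w b where w: "w \<in> power_span B x n" "b \<in> B" "w \<in> carrier R" "b \<in> carrier R"
        "y = w \<oplus> b \<otimes> P" by (rule cs)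
      have "c \<otimes> y = (c \<otimes> w) \<oplus> (c \<otimes> b) \<otimes> P" using w P c Bc by (simp add: r_distr m_assoc subset_iff)
      then show ?thesis using in_span w c S subringE(6)[OF B] by simp
    qed
  qed
qed

context
  fixes B x
  assumes B: "subring B R" and x: "x \<in> carrier R"
begin

lemma power_span_in_carrier: "y \<in> power_span B x n \<Longrightarrow> y \<in> carrier R"
  using power_span_carrier[OF subringE(1)[OF B] x] by blast

lemma power_span_mono: "m \<le> n \<Longrightarrow> power_span B x m \<subseteq> power_span B x n"
proof (rule lift_Suc_mono_le[of "power_span B x"])
  fix n show "power_span B x n \<subseteq> power_span B x (Suc n)"
  proof
    fix y assume y: "y \<in> power_span B x n"
    then show "y \<in> power_span B x (Suc n)"
      using subringE(2)[OF B] x power_span_in_carrier[OF y]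
      by (intro power_span_SucI[of y _ _ _ \<zero>]) (auto simp del: Group.nat_pow_Suc)
  qed
qed

lemma power_in_span:
  assumes "b \<in> B" "i \<le> n"
  shows "b \<otimes> x [^] i \<in> power_span B x n"
proof -
  have bc: "b \<in> carrier R" using assms subringE(1)[OF B] by blast
  have "b \<otimes> x [^] i \<in> power_span B x i"
  proof (cases i)
    case 0 then show ?thesis using assms bc by simp
  next
    case (Suc k)
    show ?thesis unfolding Suc
      using assms x bc submodD(2)[OF submod_power_span[OF B x]]
      by (intro power_span_SucI[of \<zero> _ _ _ b]) (auto simp del: Group.nat_pow_Suc)
  qed
  then show ?thesis using power_span_mono assms by blast
qed

lemma power_mult_span:
  assumes "b \<in> B" "z \<in> power_span B x n"
  shows "z \<otimes> (b \<otimes> x [^] i) \<in> power_span B x (n + i)"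
  using assms(2)
proof (induction n arbitrary: z)
  case 0
  then have "z \<otimes> (b \<otimes> x [^] i) = (z \<otimes> b) \<otimes> x [^] i"
    using assms x subringE(1)[OF B] by (auto simp: m_assoc subset_iff)
  then show ?case using power_in_span 0 assms subringE(6)[OF B] by simp
next
  case (Suc n)
  obtain w c where w: "w \<in> power_span B x n" "c \<in> B" "z = w \<oplus> c \<otimes> x [^] Suc n"
    using Suc.prems by (rule power_span_Suc_cases)
  have c: "w \<in> carrier R" "b \<in> carrier R" "c \<in> carrier R" "x [^] Suc n \<in> carrier R" "x [^] i \<in> carrier R"
    using w power_span_in_carrier subringE(1)[OF B] assms x by auto
  have "(w \<oplus> c \<otimes> P) \<otimes> (b \<otimes> x [^] i) = w \<otimes> (b \<otimes> x [^] i) \<oplus> (c \<otimes> b) \<otimes> (P \<otimes> x [^] i)"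
    if "P \<in> carrier R" for P
    using c that by (subst l_distr) (simp_all add: m_ac)
  from this[OF c(4)] have "z \<otimes> (b \<otimes> x [^] i)
      = w \<otimes> (b \<otimes> x [^] i) \<oplus> (c \<otimes> b) \<otimes> (x [^] Suc n \<otimes> x [^] i)"
    unfolding w(3) .
  also have "x [^] Suc n \<otimes> x [^] i = x [^] (Suc n + i)" using x by (rule nat_pow_mult)
  finally show ?case
    using submodD(3)[OF submod_power_span[OF B x]] subsetD[OF power_span_mono[of "n + i" "Suc n + i"] Suc.IH[OF w(1)]]
      power_in_span[OF subringE(6)[OF B w(2) assms(1)] order_refl[of "Suc n + i"]] by simp
qed

lemma power_span_mult:
  assumes "y \<in> power_span B x m" "z \<in> power_span B x n"
  shows "z \<otimes> y \<in> power_span B x (n + m)"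
  using assms(1)
proof (induction m arbitrary: y)
  case 0
  then show ?case using power_mult_span[OF _ assms(2), of y 0] subringE(1)[OF B] by auto
next
  case (Suc m)
  obtain w c where w: "w \<in> power_span B x m" "c \<in> B" "y = w \<oplus> c \<otimes> x [^] Suc m"
    using Suc.prems by (rule power_span_Suc_cases)
  have c: "w \<in> carrier R" "c \<in> carrier R" "x [^] Suc m \<in> carrier R" "z \<in> carrier R"
    using w assms power_span_in_carrier subringE(1)[OF B] x by auto
  have "z \<otimes> y = z \<otimes> w \<oplus> z \<otimes> (c \<otimes> x [^] Suc m)"
    unfolding w(3) using c by (simp add: r_distr del: Group.nat_pow_Suc)
  then show ?case
    using submodD(3)[OF submod_power_span[OF B x]] power_mult_span[OF w(2) assms(2), of "Suc m"]
      subsetD[OF power_span_mono[of "n + m" "n + Suc m"] Suc.IH[OF w(1)]] by simp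
qed

lemma adjoin_subring:
  shows "subring (\<Union>n. power_span B x n) R"
    and "B \<subseteq> (\<Union>n. power_span B x n)" "x \<in> (\<Union>n. power_span B x n)"
proof -
  show "B \<subseteq> (\<Union>n. power_span B x n)" using UN_upper[of 0 UNIV "power_span B x"] by simp
  then have one: "\<one> \<in> (\<Union>n. power_span B x n)" using subringE(3)[OF B] by blast
  have "x \<in> power_span B x 1"
    using power_in_span[of \<one> 1 1] subringE(3)[OF B] x by simp
  then show "x \<in> (\<Union>n. power_span B x n)" by blast
  note S = submodD[OF submod_power_span[OF B x]]
  show "subring (\<Union>n. power_span B x n) R"
  proof (rule subringI)
    show "(\<Union>n. power_span B x n) \<subseteq> carrier R" using S(1) by blast
    show "\<ominus> y \<in> (\<Union>n. power_span B x n)" if "y \<in> (\<Union>n. power_span B x n)" for y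
      using that S(4) by blast
    fix y z assume "y \<in> (\<Union>n. power_span B x n)" "z \<in> (\<Union>n. power_span B x n)"
    then obtain m n where mn: "y \<in> power_span B x m" "z \<in> power_span B x n" by blast
    show "y \<otimes> z \<in> (\<Union>n. power_span B x n)" using power_span_mult[OF mn(2,1)] by blast
    have "y \<in> power_span B x (max m n)" "z \<in> power_span B x (max m n)"
      using mn power_span_mono[of m "max m n"] power_span_mono[of n "max m n"] by auto
    then show "y \<oplus> z \<in> (\<Union>n. power_span B x n)" using S(3) by blast
  qed (rule one)
qed

end

text \<open>
  In \<open>(b\<^sub>0 + b\<^sub>1 / x + \<dots> + b\<^sub>m / x\<^sup>m) x\<^sup>k\<^sup>+\<^sup>1\<close> only the term of \<open>b\<^sub>0\<close> has an exponent above \<open>k\<close>.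
\<close>

lemma power_span_inverse:
  assumes B: "subring B R" and x: "x \<in> carrier R" "x \<noteq> \<zero>"
    and "y \<in> power_span B (inv x) m" "m \<le> Suc k"
  shows "\<exists>b\<in>B. \<exists>w\<in>power_span B x k. y \<otimes> x [^] Suc k = b \<otimes> x [^] Suc k \<oplus> w"
  using assms(4,5)
proof (induction m arbitrary: y)
  case 0
  then have "y \<in> B" "y \<in> carrier R" using subringE(1)[OF B] by auto
  then show ?case using x submodD(2)[OF submod_power_span[OF B x(1)]]
    by (intro bexI[of _ y] bexI[of _ \<zero>]) auto
next
  case (Suc m)
  have ix: "inv x \<in> carrier R" using nonzero_inv x by blast
  obtain v c where v: "v \<in> power_span B (inv x) m" "c \<in> B" "y = v \<oplus> c \<otimes> inv x [^] Suc m"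
    using Suc.prems(1) by (rule power_span_Suc_cases)
  obtain b w where b: "b \<in> B" "w \<in> power_span B x k" "v \<otimes> x [^] Suc k = b \<otimes> x [^] Suc k \<oplus> w"
    using Suc.IH[OF v(1)] Suc.prems by auto
  have "x [^] Suc k = x [^] (Suc m + (k - m))" using Suc.prems by simp
  also have "\<dots> = x [^] Suc m \<otimes> x [^] (k - m)" using x nat_pow_mult by metis
  finally have "inv x [^] Suc m \<otimes> x [^] Suc k = inv x [^] Suc m \<otimes> (x [^] Suc m \<otimes> x [^] (k - m))"
    by (simp only:)
  also have "\<dots> = (inv x [^] Suc m \<otimes> x [^] Suc m) \<otimes> x [^] (k - m)"
    using x ix nat_pow_closed by (metis m_assoc)
  also have "inv x [^] Suc m \<otimes> x [^] Suc m = \<one>"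
    using nat_pow_distrib[of "inv x" x "Suc m"] x ix nonzero_inv[of x] nat_pow_one by (metis)
  finally have p: "inv x [^] Suc m \<otimes> x [^] Suc k = x [^] (k - m)" using x by (simp del: Group.nat_pow_Suc)
  have c: "v \<in> carrier R" "c \<in> carrier R" "x [^] Suc k \<in> carrier R" "inv x [^] Suc m \<in> carrier R"
    "b \<in> carrier R" "w \<in> carrier R"
    using v b power_span_in_carrier[OF B ix] power_span_in_carrier[OF B x(1)] subringE(1)[OF B]
      x ix by auto
  have "y \<otimes> x [^] Suc k = v \<otimes> x [^] Suc k \<oplus> c \<otimes> (inv x [^] Suc m \<otimes> x [^] Suc k)"
    unfolding v(3) using c by (simp add: l_distr m_assoc del: Group.nat_pow_Suc)
  also have "\<dots> = b \<otimes> x [^] Suc k \<oplus> (w \<oplus> c \<otimes> x [^] (k - m))"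
    unfolding p b(3) using c x by (simp add: a_assoc del: Group.nat_pow_Suc)
  finally show ?case
    using b submodD(3)[OF submod_power_span[OF B x(1)] b(2)] power_in_span[OF B x(1) v(2), of "k - m" k] by auto
qed

lemma power_span_clear:
  assumes B: "subring B R" and u: "u \<in> B" "u \<noteq> \<zero>" and "y \<in> power_span B (inv u) n"
  shows "y \<otimes> u [^] n \<in> B"
  using assms(4)
proof (induction n arbitrary: y)
  case 0 then show ?case using subringE(1)[OF B] by auto
next
  case (Suc n)
  have uc: "u \<in> carrier R" "inv u \<in> carrier R" using u subringE(1)[OF B] nonzero_inv[of u] by auto
  obtain v c where v: "v \<in> power_span B (inv u) n" "c \<in> B" "y = v \<oplus> c \<otimes> inv u [^] Suc n"
    using Suc.prems by (rule power_span_Suc_cases)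
  have c: "v \<in> carrier R" "c \<in> carrier R" "u [^] Suc n \<in> carrier R" "inv u [^] Suc n \<in> carrier R"
    using v power_span_in_carrier[OF B uc(2)] subringE(1)[OF B] uc by auto
  have "inv u [^] Suc n \<otimes> u [^] Suc n = \<one>"
    using nat_pow_distrib[of "inv u" u "Suc n"] uc u nonzero_inv[of u] nat_pow_one by metis
  then have "y \<otimes> u [^] Suc n = v \<otimes> u [^] Suc n \<oplus> c"
    unfolding v(3) using c by (simp add: l_distr m_assoc del: Group.nat_pow_Suc)
  also have "v \<otimes> u [^] Suc n = v \<otimes> u [^] n \<otimes> u" using c uc by (simp add: m_assoc)
  finally show ?case using Suc.IH[OF v(1)] v u subringE(6,7)[OF B] by simp
qed

text \<open>
  By Zorn's lemma there is an overring \<open>B\<close> that is maximal among those without \<open>1 / d\<close>. By maximality,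
  \<open>1 / d\<close> lies in \<open>B[y]\<close> for every \<open>y \<notin> B\<close>.

  Every \<open>u = 1 - d b\<close> with \<open>b \<in> B\<close> is a unit of \<open>B\<close>: otherwise \<open>u\<^sup>n / d \<in> B\<close> for some \<open>n\<close>, and
  \<open>u\<^sup>n\<close> is again of the form \<open>1 - d c\<close>, so \<open>1 / d - c \<in> B\<close>.

  Suppose that neither \<open>x\<close> nor \<open>1 / x\<close> is in \<open>B\<close>. Write \<open>1 / d\<close> as a polynomial in \<open>x\<close> and as a
  polynomial in \<open>1 / x\<close>, both over \<open>B\<close> and of least degree, \<open>n\<close> and \<open>m\<close>. By symmetry let
  \<open>m \<le> n\<close>. Multiplying the second expression by \<open>d x\<^sup>n\<close> and dividing by the unit \<open>1 - d b\<close>, where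
  \<open>b\<close> is its constant coefficient, expresses \<open>x\<^sup>n\<close> through lower powers of \<open>x\<close>. Inserting this into
  the first expression contradicts the choice of \<open>n\<close>.
\<close>

lemma valuation_overring_exists:
  assumes D: "subring D R" and d: "d \<in> D" "d \<noteq> \<zero>" "inv d \<notin> D"
  obtains V where "subring V R" "D \<subseteq> V" "inv d \<notin> V"
    "\<And>x. x \<in> carrier R \<Longrightarrow> x \<noteq> \<zero> \<Longrightarrow> x \<in> V \<or> inv x \<in> V"
proof -
  define S where "S = {B. subring B R \<and> D \<subseteq> B \<and> inv d \<notin> B}"
  have "\<exists>B\<in>S. \<forall>C\<in>S. B \<subseteq> C \<longrightarrow> C = B"
  proof (rule subset_Zorn_nonempty)
    show "S \<noteq> {}" using D d unfolding S_def by blast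
    fix CH assume ne: "CH \<noteq> {}" and chain: "subset.chain S CH"
    have sub: "CH \<subseteq> S" and tot: "\<And>U Y. U \<in> CH \<Longrightarrow> Y \<in> CH \<Longrightarrow> U \<subseteq> Y \<or> Y \<subseteq> U"
      using chain unfolding subset_chain_def by auto
    have ring: "subring U R" if "U \<in> CH" for U using sub that unfolding S_def by blast
    have "subring (\<Union>CH) R"
    proof (rule subringI)
      show "\<Union>CH \<subseteq> carrier R" using subringE(1)[OF ring] by blast
      show "\<one> \<in> \<Union>CH" using subringE(3)[OF ring] ne by blast
      show "\<ominus> y \<in> \<Union>CH" if y: "y \<in> \<Union>CH" for y
      proof -
        obtain U where "U \<in> CH" "y \<in> U" using y by (rule UnionE)
        then show ?thesis using subringE(5)[OF ring] by (intro UnionI)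
      qed
      fix y z assume "y \<in> \<Union>CH" "z \<in> \<Union>CH"
      then obtain U V where "U \<in> CH" "y \<in> U" "V \<in> CH" "z \<in> V" by (elim UnionE)
      then obtain W where W: "W \<in> CH" "y \<in> W" "z \<in> W" using tot[of U V] by blast
      then show "y \<otimes> z \<in> \<Union>CH" "y \<oplus> z \<in> \<Union>CH"
        using subringE(6,7)[OF ring[OF W(1)], of y z] by blast+
    qed
    then show "\<Union>CH \<in> S" using sub ne unfolding S_def by blast
  qed
  then obtain B where "B \<in> S" and maxS: "\<And>C. C \<in> S \<Longrightarrow> B \<subseteq> C \<Longrightarrow> C = B" by blast
  then have B: "subring B R" "D \<subseteq> B" "inv d \<notin> B" unfolding S_def by auto
  have Bc: "B \<subseteq> carrier R" using subringE(1)[OF B(1)] .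
  have dB: "d \<in> B" "d \<in> carrier R" using d B Bc by auto
  have id: "inv d \<in> carrier R" "inv d \<otimes> d = \<one>" "d \<otimes> inv d = \<one>"
    using nonzero_inv[OF dB(2) d(2)] by auto
  note Bm = subringE(6)[OF B(1)] and Ba = subringE(7)[OF B(1)] and Bn = subringE(5)[OF B(1)]
    and B1 = subringE(3)[OF B(1)]
  have adjoin: "\<exists>n. inv d \<in> power_span B y n" if y: "y \<in> carrier R" "y \<notin> B" for y
  proof (rule ccontr)
    assume "\<not> (\<exists>n. inv d \<in> power_span B y n)"
    then have "(\<Union>n. power_span B y n) \<in> S"
      using adjoin_subring[OF B(1) y(1)] B(2) unfolding S_def by blast
    then have "(\<Union>n. power_span B y n) = B" using maxS adjoin_subring(2)[OF B(1) y(1)] by blast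
    then show False using adjoin_subring(3)[OF B(1) y(1)] y(2) by blast
  qed
  have unit: "inv (\<one> \<ominus> d \<otimes> b) \<in> B" "\<one> \<ominus> d \<otimes> b \<noteq> \<zero>" if b: "b \<in> B" for b
  proof -
    define u where "u = \<one> \<ominus> d \<otimes> b"
    have bc: "b \<in> carrier R" using b Bc by blast
    have u: "u \<in> B" unfolding u_def minus_eq using b dB Bm Ba Bn B1 by simp
    then have uc: "u \<in> carrier R" using Bc by blast
    show u0: "u \<noteq> \<zero>"
    proof
      assume "u = \<zero>"
      then have "d \<otimes> b = \<one>" using bc dB unfolding u_def by simp
      then have "inv d = b" using comm_inv_char bc dB by blast
      then show False using B b by simp
    qed
    have pow: "\<exists>c\<in>B. u [^] n = \<one> \<ominus> d \<otimes> c" for n :: nat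
    proof (induction n)
      case 0 then show ?case using dB subringE(2)[OF B(1)] by (intro bexI[of _ \<zero>]) (auto simp: minus_eq)
    next
      case (Suc n)
      then obtain c where c: "c \<in> B" "u [^] n = \<one> \<ominus> d \<otimes> c" by blast
      then have cc: "c \<in> carrier R" using Bc by blast
      have "u [^] Suc n = u \<ominus> d \<otimes> (c \<otimes> u)"
        using c cc uc dB by (simp add: minus_eq l_distr l_minus m_assoc)
      also have "\<dots> = \<one> \<ominus> d \<otimes> (b \<oplus> c \<otimes> u)"
        using cc uc dB bc unfolding u_def by (simp add: minus_eq r_distr minus_add a_assoc)
      finally show ?case using c b u Bm Ba by blast
    qed
    \<comment> \<open>Adjoining \<open>1 / u\<close> cannot create \<open>1 / d\<close>, because powers of \<open>u\<close> are \<open>1\<close> modulo \<open>d\<close>.\<close>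
    show "inv u \<in> B"
    proof (rule ccontr)
      assume "inv u \<notin> B"
      then obtain n where "inv d \<in> power_span B (inv u) n" using adjoin[OF nonzero_inv(1)[OF uc u0]] by blast
      then have "inv d \<otimes> u [^] n \<in> B" by (rule power_span_clear[OF B(1) u u0])
      moreover obtain c where c: "c \<in> B" "u [^] n = \<one> \<ominus> d \<otimes> c" using pow by blast
      moreover from this have "inv d \<otimes> u [^] n = inv d \<ominus> c"
        using id dB Bc by (simp add: minus_eq r_distr r_minus m_assoc[symmetric] subset_iff)
      ultimately have "(inv d \<ominus> c) \<oplus> c \<in> B" using Ba by simp
      moreover have "(inv d \<ominus> c) \<oplus> c = inv d" using id c Bc by (simp add: minus_eq a_assoc l_neg subset_iff)
      ultimately show False using B by simp
    qed
  qed
  have reduce: False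
    if x: "x \<in> carrier R" "x \<noteq> \<zero>" and n: "inv d \<in> power_span B x (Suc k)" "inv d \<notin> power_span B x k"
      and m: "inv d \<in> power_span B (inv x) m" "m \<le> Suc k" for x m k
  proof -
    note S = submodD[OF submod_power_span[OF B(1) x(1)], where n1 = k]
    define P where "P = x [^] Suc k"
    have P: "P \<in> carrier R" unfolding P_def using x by (intro nat_pow_closed)
    obtain b w where b: "b \<in> B" "w \<in> power_span B x k" "inv d \<otimes> P = b \<otimes> P \<oplus> w"
      using power_span_inverse[OF B(1) x m] unfolding P_def by blast
    have bc: "b \<in> carrier R" "w \<in> carrier R" using b Bc S by auto
    define u where "u = \<one> \<ominus> d \<otimes> b"
    have u: "inv u \<in> B" "u \<noteq> \<zero>" "u \<in> carrier R" unfolding u_def using unit[OF b(1)] bc dB by blast+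
    have "P = d \<otimes> (inv d \<otimes> P)" using P dB id by (simp add: m_assoc[symmetric])
    also have "\<dots> = d \<otimes> b \<otimes> P \<oplus> d \<otimes> w" unfolding b(3) using bc P dB by (simp add: r_distr m_assoc)
    finally have Peq: "P = d \<otimes> b \<otimes> P \<oplus> d \<otimes> w" .
    have "u \<otimes> P = P \<ominus> d \<otimes> b \<otimes> P" unfolding u_def using P dB bc by (simp add: minus_eq l_distr l_minus)
    also have "\<dots> = d \<otimes> w"
    proof -
      have "P \<ominus> d \<otimes> b \<otimes> P = (d \<otimes> w \<oplus> d \<otimes> b \<otimes> P) \<ominus> d \<otimes> b \<otimes> P"
        using Peq P dB bc by (simp add: a_comm)
      then show ?thesis using P dB bc by (simp add: minus_eq a_assoc r_neg)
    qed
    finally have "inv u \<otimes> (u \<otimes> P) = inv u \<otimes> (d \<otimes> w)" by simp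
    then have "P = inv u \<otimes> (d \<otimes> w)" using u P by (simp add: inv_cancel)
    then have PS: "P \<in> power_span B x k" using u b dB S by simp
    obtain v c where "v \<in> power_span B x k" "c \<in> B" "inv d = v \<oplus> c \<otimes> P"
      using n(1) unfolding P_def by (rule power_span_Suc_cases)
    then have "inv d \<in> power_span B x k" using S PS by simp
    then show False using n by simp
  qed
  have "x \<in> B \<or> inv x \<in> B" if x: "x \<in> carrier R" "x \<noteq> \<zero>" for x
  proof (rule ccontr)
    assume no: "\<not> (x \<in> B \<or> inv x \<in> B)"
    define least where "least y = (LEAST n. inv d \<in> power_span B y n)" for y
    have least: "inv d \<in> power_span B y (least y)" "\<exists>k. least y = Suc k \<and> inv d \<notin> power_span B y k"
      if "y \<in> carrier R" "y \<notin> B" for y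
    proof -
      show *: "inv d \<in> power_span B y (least y)"
        unfolding least_def using adjoin[OF that] by (rule LeastI_ex)
      then have "least y \<noteq> 0" using B by (metis power_span.simps(1))
      then show "\<exists>k. least y = Suc k \<and> inv d \<notin> power_span B y k"
        unfolding least_def by (metis lessI not0_implies_Suc not_less_Least)
    qed
    have ix: "inv x \<in> carrier R" "inv x \<noteq> \<zero>" "inv (inv x) = x"
      using x nonzero_inv nonzero_inv_inv by auto
    show False
    proof (cases "least (inv x) \<le> least x")
      case True
      then show False using reduce x least[of x] least[of "inv x"] ix no by metis
    next
      case False
      then show False using reduce[of "inv x"] x least[of x] least[of "inv x"] ix no
        by (metis nat_le_linear)
    qed
  qed
  then show ?thesis using that B by blast
qed

end

context fraction_field
begin

text \<open>
  Let \<open>V\<close> be a valuation overring other than the quotient field, \<open>c\<close> a nonzero element of its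
  conductor, and \<open>z \<notin> J\<close>. Then \<open>c\<^sup>2 / z\<close> is a denominator of \<open>J\<close>. Indeed, for nonzero \<open>y \<in> J\<close> put
  \<open>w = c y / z\<close>. If \<open>w\<close> were not in \<open>V\<close>, then \<open>z / y = c (1 / w)\<close> would be in \<open>c V \<subseteq> A\<close>, and \<open>z\<close>
  would be in \<open>J\<close>. So \<open>w \<in> V\<close> and \<open>(c\<^sup>2 / z) y = c w \<in> A\<close>.
\<close>

lemma conducive_submod_denominator:
  assumes "conducive R A" "A \<noteq> carrier R" "submod R A J" "J \<noteq> carrier R"
  shows "\<exists>d\<in>carrier R. d \<noteq> \<zero> \<and> (\<forall>x\<in>J. d \<otimes> x \<in> A)"
proof -
  note J = submodD[OF assms(3)]
  have "\<exists>d\<in>A. d \<noteq> \<zero> \<and> inv d \<notin> A"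
  proof (rule ccontr)
    assume "\<not> ?thesis"
    then have "quotient_field R A \<subseteq> A"
      unfolding quotient_field_def using subringE(6)[OF A] by auto
    then show False using assms(2) fractions A_carrier by blast
  qed
  then obtain d where d: "d \<in> A" "d \<noteq> \<zero>" "inv d \<notin> A" by blast
  obtain V where V: "subring V R" "A \<subseteq> V" "inv d \<notin> V"
    and val: "\<And>x. x \<in> carrier R \<Longrightarrow> x \<noteq> \<zero> \<Longrightarrow> x \<in> V \<or> inv x \<in> V"
    using valuation_overring_exists[OF A d] by blast
  have "V \<noteq> carrier R" using V d A_carrier nonzero_inv by blast
  then have "conductor R A V \<noteq> {\<zero>}"
    using assms(1) V subringE(1)[OF V(1)] unfolding conducive_def overring_def fractions by blast
  moreover have "\<zero> \<in> conductor R A V"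
    using subringE(2)[OF A] subringE(1)[OF V(1)] unfolding conductor_def fractions by auto
  ultimately obtain c where c: "c \<in> carrier R" "c \<noteq> \<zero>" "\<And>v. v \<in> V \<Longrightarrow> c \<otimes> v \<in> A"
    unfolding conductor_def fractions by blast
  obtain z where z: "z \<in> carrier R" "z \<notin> J" using assms(4) J(1) by blast
  have z0: "z \<noteq> \<zero>" using z J(2) by auto
  note iz = nonzero_inv[OF z(1) z0] and ic = nonzero_inv[OF c(1,2)]
  have "c \<otimes> (c \<otimes> inv z) \<otimes> y \<in> A" if y: "y \<in> J" for y
  proof (cases "y = \<zero>")
    case True
    then show ?thesis using c z iz subringE(2)[OF A] by simp
  next
    case False
    have yc: "y \<in> carrier R" using y J by blast
    note iy = nonzero_inv[OF yc False]
    define w where "w = (c \<otimes> inv z) \<otimes> y"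
    have w: "w \<in> carrier R" "w \<noteq> \<zero>" unfolding w_def using c iz yc False by (auto simp: integral_iff)
    have "w \<in> V"
    proof (rule ccontr)
      assume "w \<notin> V"
      then have "c \<otimes> inv w \<in> A" using val w c by blast
      moreover have "inv w = inv c \<otimes> z \<otimes> inv y"
        unfolding w_def using c z z0 iz yc False ic
        by (simp add: nonzero_inv_mult nonzero_inv_inv integral_iff)
      ultimately have "z \<otimes> inv y \<in> A" using c ic z iy by (simp add: inv_cancel m_assoc)
      then have "z \<otimes> inv y \<otimes> y \<in> J" using J y by blast
      then show False using z iy yc by (simp add: m_assoc)
    qed
    then show ?thesis unfolding w_def using c iz yc by (simp add: m_assoc)
  qed
  then show ?thesis using c iz by (intro bexI[of _ "c \<otimes> (c \<otimes> inv z)"]) (auto simp: integral_iff)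
qed

end

section \<open>Ideals that are modules over a valuation domain\<close>

context fraction_field
begin

text \<open>
  The inverse is the largest possible one, \<open>J = (I : I I)\<close>, and only \<open>I \<subseteq> I I J\<close> needs an argument. Let
  \<open>x \<in> I\<close> be nonzero. If \<open>(y / x) I \<subseteq> I\<close> for all \<open>y \<in> I\<close>, then \<open>1 / x \<in> J\<close> and
  \<open>x = x x (1 / x)\<close>. Otherwise there are \<open>y, z \<in> I\<close> with \<open>y z / x \<notin> I\<close>. In a valuation domain an
  element outside the module \<open>I\<close> divides every element of \<open>I\<close>, so \<open>x / (y z)\<close> maps \<open>I\<close> into \<open>V\<close>.
  Hence it lies in \<open>J\<close>, and \<open>x = y z (x / (y z))\<close>.
\<close>

lemma valuation_vn_regular:
  assumes I: "I \<in> fractional_ideals" and V: "V \<subseteq> carrier R" "A \<subseteq> V" "submod R V I"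
    and val: "\<And>x. x \<in> carrier R \<Longrightarrow> x \<noteq> \<zero> \<Longrightarrow> x \<in> V \<or> inv x \<in> V"
  shows "vn_regular I"
proof -
  note S = submodD[OF V(3)]
  have IA: "submod R A I" using fractional_idealD(1)[OF I] .
  have Ic: "y \<in> carrier R" if "y \<in> I" for y using that S(1) by blast
  define J where "J = {y \<in> carrier R. \<forall>a\<in>I. \<forall>b\<in>I. y \<otimes> a \<otimes> b \<in> I}"
  have cover: "x \<in> I \<cdot> I \<cdot> J" if x: "x \<in> I" for x
  proof (cases "x = \<zero>")
    case True
    have "\<zero> \<in> J" unfolding J_def using S(2) Ic by auto
    then have "\<zero> \<otimes> \<zero> \<otimes> \<zero> \<in> I \<cdot> I \<cdot> J" using S(2) by (intro ideal_prod.prod)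
    then show ?thesis using True by simp
  next
    case False
    note xc = Ic[OF x] and ix = nonzero_inv[OF Ic[OF x] False]
    \<comment> \<open>Both cases below write \<open>x\<close> as \<open>y z (x / (y z))\<close>, the first one with \<open>y = z = x\<close>.\<close>
    have *: "x \<in> I \<cdot> I \<cdot> J"
      if y: "y \<in> I" "y \<noteq> \<zero>" and z: "z \<in> I" "z \<noteq> \<zero>"
        and j: "\<And>a b. a \<in> I \<Longrightarrow> b \<in> I \<Longrightarrow> x \<otimes> inv y \<otimes> inv z \<otimes> a \<otimes> b \<in> I" for y z
    proof -
      note iy = nonzero_inv[OF Ic[OF y(1)] y(2)] and iz = nonzero_inv[OF Ic[OF z(1)] z(2)]
      have "x \<otimes> inv y \<otimes> inv z \<in> J" unfolding J_def using xc iy iz j by simp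
      then have "y \<otimes> z \<otimes> (x \<otimes> inv y \<otimes> inv z) \<in> I \<cdot> I \<cdot> J" using y z by (intro ideal_prod.prod)
      moreover have "y \<otimes> z \<otimes> (x \<otimes> inv y \<otimes> inv z) = (y \<otimes> inv y) \<otimes> (z \<otimes> inv z) \<otimes> x"
        using xc iy(1) iz(1) Ic[OF y(1)] Ic[OF z(1)] by (simp add: m_ac)
      ultimately show ?thesis using iy iz xc by simp
    qed
    show ?thesis
    proof (cases "\<forall>y\<in>I. \<forall>b\<in>I. y \<otimes> inv x \<otimes> b \<in> I")
      case True
      show ?thesis
      proof (rule *[OF x False x False])
        fix a b assume ab: "a \<in> I" "b \<in> I"
        have "x \<otimes> inv x \<otimes> inv x \<otimes> a \<otimes> b = a \<otimes> inv x \<otimes> b"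
          using xc ix ab Ic by (simp add: m_ac inv_cancel)
        then show "x \<otimes> inv x \<otimes> inv x \<otimes> a \<otimes> b \<in> I" using True ab by simp
      qed
    next
      case no: False
      then obtain y z where y: "y \<in> I" and z: "z \<in> I" and out: "y \<otimes> inv x \<otimes> z \<notin> I" by blast
      note yc = Ic[OF y] and zc = Ic[OF z]
      have y0: "y \<noteq> \<zero>" and z0: "z \<noteq> \<zero>" using out S(2) xc ix yc zc by auto
      note iy = nonzero_inv[OF yc y0] and iz = nonzero_inv[OF zc z0]
      have key: "x \<otimes> inv y \<otimes> inv z \<otimes> w \<in> V" if w: "w \<in> I" for w
      proof (rule ccontr)
        define u where "u = x \<otimes> inv y \<otimes> inv z \<otimes> w"
        assume "x \<otimes> inv y \<otimes> inv z \<otimes> w \<notin> V"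
        then have uV: "u \<notin> V" unfolding u_def .
        have wc: "w \<in> carrier R" using Ic w by blast
        have uc: "u \<in> carrier R" unfolding u_def using xc iy iz wc by simp
        have "\<zero> \<in> V" using V(2) subringE(2)[OF A] by blast
        then have u0: "u \<noteq> \<zero>" using uV by blast
        then have w0: "w \<noteq> \<zero>" using xc iy iz unfolding u_def by auto
        note iw = nonzero_inv[OF wc w0] and iu = nonzero_inv[OF uc u0]
        have "inv u \<in> V" using val uV uc u0 by blast
        then have "inv u \<otimes> w \<in> I" using S(5) w by blast
        moreover have "inv u \<otimes> w = y \<otimes> inv x \<otimes> z"
        proof -
          have "u \<otimes> (y \<otimes> inv x \<otimes> z) = (x \<otimes> inv x) \<otimes> (y \<otimes> inv y) \<otimes> (z \<otimes> inv z) \<otimes> w"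
            unfolding u_def using xc ix(1) yc zc iy(1) iz(1) wc by (simp add: m_ac)
          also have "\<dots> = w" using ix iy iz wc by simp
          finally have "inv u \<otimes> (u \<otimes> (y \<otimes> inv x \<otimes> z)) = inv u \<otimes> w" by simp
          then show ?thesis using uc u0 xc ix yc zc by (simp add: inv_cancel)
        qed
        ultimately show False using out by simp
      qed
      show ?thesis
      proof (rule *[OF y y0 z z0])
        fix a b assume ab: "a \<in> I" "b \<in> I"
        show "x \<otimes> inv y \<otimes> inv z \<otimes> a \<otimes> b \<in> I" using key[OF ab(1)] ab(2) S(5) by blast
      qed
    qed
  qed
  obtain d i where d: "d \<in> A" "d \<noteq> \<zero>" "\<forall>x\<in>I. d \<otimes> x \<in> A" and i: "i \<in> I" "i \<noteq> \<zero>"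
    using fractional_idealD(3,4)[OF I] by blast
  have dc: "d \<in> carrier R" "i \<in> carrier R" using d i A_carrier Ic by auto
  have "J \<in> fractional_ideals"
  proof (rule fractional_idealI)
    show "submod R A J"
    proof (rule submodI)
      show "J \<subseteq> carrier R" unfolding J_def by blast
      show "\<zero> \<in> J" unfolding J_def using S(2) Ic by auto
      show "x \<oplus> y \<in> J" if "x \<in> J" "y \<in> J" for x y
        using that S(3) Ic unfolding J_def by (auto simp: l_distr)
      show "\<ominus> x \<in> J" if "x \<in> J" for x
        using that S(4) Ic unfolding J_def by (auto simp: l_minus)
      show "a \<otimes> x \<in> J" if "a \<in> A" "x \<in> J" for a x
      proof -
        have "a \<otimes> x \<otimes> u \<otimes> v = a \<otimes> (x \<otimes> u \<otimes> v)" if "u \<in> I" "v \<in> I" for u v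
          using \<open>a \<in> A\<close> \<open>x \<in> J\<close> that Ic A_carrier by (auto simp: m_assoc J_def)
        then show ?thesis
          using that A_carrier submodD(5)[OF IA] unfolding J_def by auto
      qed
    qed
    show "d \<otimes> i \<otimes> i \<in> carrier R" "d \<otimes> i \<otimes> i \<noteq> \<zero>" using dc d i by (auto simp: integral_iff)
    show "d \<otimes> i \<otimes> i \<otimes> x \<in> A" if "x \<in> J" for x
    proof -
      have "x \<in> carrier R" "x \<otimes> i \<otimes> i \<in> I" using that i unfolding J_def by auto
      moreover from this(1) have "d \<otimes> i \<otimes> i \<otimes> x = d \<otimes> (x \<otimes> i \<otimes> i)" using dc by (simp add: m_ac)
      ultimately show ?thesis using d by simp
    qed
    have "d \<otimes> a \<otimes> b \<in> I" if "a \<in> I" "b \<in> I" for a b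
      using submodD(5)[OF IA] d that by simp
    then show "d \<in> J" unfolding J_def using dc by simp
  qed (rule d)
  moreover have "I \<cdot> I \<cdot> J \<subseteq> I"
  proof -
    have "I \<cdot> I \<cdot> J = J \<cdot> (I \<cdot> I)"
      using S(1) J_def by (intro prod_comm prod_in_carrier) auto
    also have "\<dots> = J \<cdot> I \<cdot> I" using S(1) J_def by (intro prod_assoc[symmetric]) auto
    also have "\<dots> \<subseteq> I"
    proof (rule prod_least)
      fix s b assume s: "s \<in> J \<cdot> I" and b: "b \<in> I"
      from s show "s \<otimes> b \<in> I"
      proof induction
        case (prod j a) then show ?case using b unfolding J_def by simp
      next
        case (sum s t)
        have "J \<cdot> I \<subseteq> carrier R" using S(1) J_def by (intro prod_in_carrier) auto
        then have "s \<in> carrier R" "t \<in> carrier R" using sum by auto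
        with sum show ?case using b Ic S(3) by (simp add: l_distr)
      qed
    qed (rule S(3))
    finally show ?thesis .
  qed
  ultimately show ?thesis unfolding vn_regular_def using cover by blast
qed

end

section \<open>Pullbacks along a residue map\<close>

locale residue_pullback = L: field L + K: fraction_field K D
  for L :: "('a, 'm) ring_scheme" and K :: "('b, 'n) ring_scheme" and D +
  fixes T and \<phi> :: "'a \<Rightarrow> 'b"
  assumes T: "subring T L" and T_fractions: "quotient_field L T = carrier L"
    and hom: "\<phi> \<in> ring_hom (L\<lparr>carrier := T\<rparr>) K"
    and surj: "\<phi> ` T = carrier K"
begin

definition preimage where "preimage J = {t \<in> T. \<phi> t \<in> J}"

abbreviation "M \<equiv> preimage {\<zero>\<^bsub>K\<^esub>}"

lemma T_carrier: "t \<in> T \<Longrightarrow> t \<in> carrier L" using subringE(1)[OF T] by blast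

lemmas T_closed = subringE(2,3,5,6,7)[OF T]

lemma phi_carrier: "t \<in> T \<Longrightarrow> \<phi> t \<in> carrier K" using surj by blast
lemma phi_mult: "s \<in> T \<Longrightarrow> t \<in> T \<Longrightarrow> \<phi> (s \<otimes>\<^bsub>L\<^esub> t) = \<phi> s \<otimes>\<^bsub>K\<^esub> \<phi> t"
  using ring_hom_mult[OF hom] by simp
lemma phi_add: "s \<in> T \<Longrightarrow> t \<in> T \<Longrightarrow> \<phi> (s \<oplus>\<^bsub>L\<^esub> t) = \<phi> s \<oplus>\<^bsub>K\<^esub> \<phi> t"
  using ring_hom_add[OF hom] by simp
lemma phi_one: "\<phi> \<one>\<^bsub>L\<^esub> = \<one>\<^bsub>K\<^esub>"
  using ring_hom_one[OF hom] by simp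
lemma phi_zero: "\<phi> \<zero>\<^bsub>L\<^esub> = \<zero>\<^bsub>K\<^esub>"
  using ring_hom_zero[OF hom L.subring_is_ring[OF T] K.ring_axioms] by simp
lemma phi_minus:
  assumes "t \<in> T" shows "\<phi> (\<ominus>\<^bsub>L\<^esub> t) = \<ominus>\<^bsub>K\<^esub> \<phi> t"
proof -
  have "\<phi> (\<ominus>\<^bsub>L\<^esub> t) \<oplus>\<^bsub>K\<^esub> \<phi> t = \<phi> (\<ominus>\<^bsub>L\<^esub> t \<oplus>\<^bsub>L\<^esub> t)"
    using assms T_closed by (simp add: phi_add)
  also have "\<dots> = \<zero>\<^bsub>K\<^esub>" using T_carrier[OF assms] by (simp add: L.l_neg phi_zero)
  finally show ?thesis
    using K.minus_equality phi_carrier assms T_closed by metis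
qed

lemmas phi_simps = phi_mult phi_add phi_one phi_zero phi_minus

lemma lift:
  assumes "k \<in> carrier K" obtains t where "t \<in> T" "\<phi> t = k"
proof -
  have "k \<in> \<phi> ` T" using assms by (simp add: surj)
  then obtain t where "k = \<phi> t" "t \<in> T" by (rule imageE)
  then show thesis using that by simp
qed

lemma preimage_subset: "preimage J \<subseteq> T" unfolding preimage_def by blast

lemma preimage_subset_carrier: "preimage J \<subseteq> carrier L" using preimage_subset T_carrier by blast

lemma image_preimage: "J \<subseteq> carrier K \<Longrightarrow> \<phi> ` preimage J = J"
  using surj unfolding preimage_def by auto

lemma submod_preimage:
  assumes "submod K D J"
  shows "submod L (preimage D) (preimage J)"
proof (rule L.submodI)
  note J = submodD[OF assms]
  show "preimage J \<subseteq> carrier L" by (rule preimage_subset_carrier)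
  show "\<zero>\<^bsub>L\<^esub> \<in> preimage J" using J(2) T_closed(1) by (simp add: preimage_def phi_zero)
  show "x \<oplus>\<^bsub>L\<^esub> y \<in> preimage J" if "x \<in> preimage J" "y \<in> preimage J" for x y
    using that J(3) T_closed(5) by (simp add: preimage_def phi_add)
  show "\<ominus>\<^bsub>L\<^esub> x \<in> preimage J" if "x \<in> preimage J" for x
    using that J(4) T_closed(3) by (simp add: preimage_def phi_minus)
  show "a \<otimes>\<^bsub>L\<^esub> x \<in> preimage J" if "a \<in> preimage D" "x \<in> preimage J" for a x
    using that J(5) T_closed(4) by (simp add: preimage_def phi_mult)
qed

lemma subring_preimage: "subring (preimage D) L"
proof (rule L.subringI)
  show "preimage D \<subseteq> carrier L" by (rule preimage_subset_carrier)
  show "\<one>\<^bsub>L\<^esub> \<in> preimage D" using K.one_A T_closed(2) by (simp add: preimage_def phi_one)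
qed (use submodD[OF submod_preimage[OF K.subring_submod[OF K.A]]] in blast)+

text \<open>
  A denominator \<open>b \<in> D\<close> of \<open>\<phi> t \<in> K\<close> lifts to a denominator of \<open>t\<close>. In particular the pullback has
  the same quotient field as \<open>T\<close>.
\<close>

lemma T_fraction:
  assumes t: "t \<in> T"
  obtains r s where "r \<in> preimage D" "s \<in> preimage D" "s \<noteq> \<zero>\<^bsub>L\<^esub>" "s \<otimes>\<^bsub>L\<^esub> t = r"
proof -
  obtain a b where ab: "a \<in> D" "b \<in> D" "b \<noteq> \<zero>\<^bsub>K\<^esub>" "b \<otimes>\<^bsub>K\<^esub> \<phi> t = a"
    using K.fraction phi_carrier t by blast
  obtain s where s: "s \<in> T" "\<phi> s = b" using lift ab K.A_carrier by blast
  have "s \<in> preimage D" "s \<otimes>\<^bsub>L\<^esub> t \<in> preimage D" "s \<noteq> \<zero>\<^bsub>L\<^esub>"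
    using s ab t T_closed unfolding preimage_def by (auto simp: phi_simps)
  then show thesis using that by blast
qed

lemma preimage_fractions: "quotient_field L (preimage D) = carrier L"
proof
  show "quotient_field L (preimage D) \<subseteq> carrier L"
    using L.nonzero_inv(1) subsetD[OF preimage_subset_carrier] unfolding quotient_field_def by auto
  show "carrier L \<subseteq> quotient_field L (preimage D)"
  proof
    fix x assume "x \<in> carrier L"
    then obtain t u where t: "t \<in> T" and u: "u \<in> T" "u \<noteq> \<zero>\<^bsub>L\<^esub>" and x: "x = t \<otimes>\<^bsub>L\<^esub> inv\<^bsub>L\<^esub> u"
      unfolding T_fractions[symmetric] quotient_field_def by blast
    obtain r s where r: "r \<in> preimage D" "s \<in> preimage D" "s \<noteq> \<zero>\<^bsub>L\<^esub>" "s \<otimes>\<^bsub>L\<^esub> t = r" using T_fraction[OF t] .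
    obtain p q where p: "p \<in> preimage D" "q \<in> preimage D" "q \<noteq> \<zero>\<^bsub>L\<^esub>" "q \<otimes>\<^bsub>L\<^esub> u = p" using T_fraction[OF u(1)] .
    have c: "t \<in> carrier L" "u \<in> carrier L" "s \<in> carrier L" "q \<in> carrier L"
      using t u r p T_carrier preimage_subset_carrier by blast+
    note i = L.nonzero_inv[OF c(2) u(2)] L.nonzero_inv[OF c(3) r(3)] L.nonzero_inv[OF c(4) p(3)]
    have rq: "q \<otimes>\<^bsub>L\<^esub> (s \<otimes>\<^bsub>L\<^esub> t) \<in> preimage D" "s \<otimes>\<^bsub>L\<^esub> (q \<otimes>\<^bsub>L\<^esub> u) \<in> preimage D"
      using r p subringE(6)[OF subring_preimage] by auto
    have "s \<otimes>\<^bsub>L\<^esub> (q \<otimes>\<^bsub>L\<^esub> u) \<noteq> \<zero>\<^bsub>L\<^esub>" using c r(3) p(3) u(2) by (simp add: L.integral_iff)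
    moreover have "x = q \<otimes>\<^bsub>L\<^esub> (s \<otimes>\<^bsub>L\<^esub> t) \<otimes>\<^bsub>L\<^esub> inv\<^bsub>L\<^esub> (s \<otimes>\<^bsub>L\<^esub> (q \<otimes>\<^bsub>L\<^esub> u))"
    proof -
      have "q \<otimes>\<^bsub>L\<^esub> (s \<otimes>\<^bsub>L\<^esub> t) \<otimes>\<^bsub>L\<^esub> inv\<^bsub>L\<^esub> (s \<otimes>\<^bsub>L\<^esub> (q \<otimes>\<^bsub>L\<^esub> u))
          = (q \<otimes>\<^bsub>L\<^esub> inv\<^bsub>L\<^esub> q) \<otimes>\<^bsub>L\<^esub> (s \<otimes>\<^bsub>L\<^esub> inv\<^bsub>L\<^esub> s) \<otimes>\<^bsub>L\<^esub> (t \<otimes>\<^bsub>L\<^esub> inv\<^bsub>L\<^esub> u)"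
        using c i(1,5,9) r(3) p(3) u(2)
        by (simp add: L.nonzero_inv_mult L.integral_iff L.m_ac)
      then show ?thesis unfolding x using c i by simp
    qed
    ultimately show "x \<in> quotient_field L (preimage D)"
      unfolding quotient_field_def using rq by blast
  qed
qed

sublocale pullback: fraction_field L "preimage D"
  by (intro fraction_field.intro fraction_field_axioms.intro L.field_axioms subring_preimage preimage_fractions)

text \<open>
  If \<open>b\<close> is an inverse of \<open>a\<close> modulo \<open>M\<close>, then \<open>m = a (m b) - m (a b - 1)\<close>, where \<open>m b\<close>, \<open>m\<close> and
  \<open>a b - 1\<close> all lie in \<open>M\<close>.
\<close>

lemma M_absorbed:
  assumes a: "a \<in> T" "\<phi> a \<noteq> \<zero>\<^bsub>K\<^esub>" and I: "a \<in> I" "M \<subseteq> I" and J: "M \<subseteq> J"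
  shows "M \<subseteq> I \<cdot>\<^bsub>L\<^esub> J"
proof
  fix m assume m: "m \<in> M"
  obtain b where b: "b \<in> T" "\<phi> b = inv\<^bsub>K\<^esub> (\<phi> a)"
    using lift K.nonzero_inv(1) phi_carrier a by metis
  have mT: "m \<in> T" "\<phi> m = \<zero>\<^bsub>K\<^esub>" using m by (auto simp: preimage_def)
  note inv = K.nonzero_inv[OF phi_carrier[OF a(1)] a(2)]
  have "\<ominus>\<^bsub>L\<^esub> m \<in> M" "m \<otimes>\<^bsub>L\<^esub> b \<in> M" "a \<otimes>\<^bsub>L\<^esub> b \<oplus>\<^bsub>L\<^esub> \<ominus>\<^bsub>L\<^esub> \<one>\<^bsub>L\<^esub> \<in> M"
    using mT a b T_closed inv phi_carrier by (auto simp: preimage_def phi_simps K.r_neg)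
  then have "a \<otimes>\<^bsub>L\<^esub> (m \<otimes>\<^bsub>L\<^esub> b) \<oplus>\<^bsub>L\<^esub> (\<ominus>\<^bsub>L\<^esub> m) \<otimes>\<^bsub>L\<^esub> (a \<otimes>\<^bsub>L\<^esub> b \<oplus>\<^bsub>L\<^esub> \<ominus>\<^bsub>L\<^esub> \<one>\<^bsub>L\<^esub>) \<in> I \<cdot>\<^bsub>L\<^esub> J"
    using I J by (blast intro: ideal_prod.intros)
  moreover have "a \<otimes>\<^bsub>L\<^esub> (m \<otimes>\<^bsub>L\<^esub> b) \<oplus>\<^bsub>L\<^esub> (\<ominus>\<^bsub>L\<^esub> m) \<otimes>\<^bsub>L\<^esub> (a \<otimes>\<^bsub>L\<^esub> b \<oplus>\<^bsub>L\<^esub> \<ominus>\<^bsub>L\<^esub> \<one>\<^bsub>L\<^esub>) = m"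
  proof -
    have c: "a \<in> carrier L" "b \<in> carrier L" "m \<in> carrier L" using a b mT T_carrier by auto
    then have "(\<ominus>\<^bsub>L\<^esub> m) \<otimes>\<^bsub>L\<^esub> (a \<otimes>\<^bsub>L\<^esub> b \<oplus>\<^bsub>L\<^esub> \<ominus>\<^bsub>L\<^esub> \<one>\<^bsub>L\<^esub>) = \<ominus>\<^bsub>L\<^esub> (a \<otimes>\<^bsub>L\<^esub> (m \<otimes>\<^bsub>L\<^esub> b)) \<oplus>\<^bsub>L\<^esub> m"
      by (simp add: L.r_distr L.l_minus L.r_minus L.m_lcomm)
    then show ?thesis using c by (simp add: L.a_assoc[symmetric] L.r_neg)
  qed
  ultimately show "m \<in> I \<cdot>\<^bsub>L\<^esub> J" by simp
qed

lemma M_subset_preimage: "submod K D J \<Longrightarrow> M \<subseteq> preimage J"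
  using submodD(2)[of K D J] unfolding preimage_def by auto

lemma image_prod:
  assumes "I \<subseteq> T" "J \<subseteq> T"
  shows "I \<cdot>\<^bsub>L\<^esub> J \<subseteq> T" "\<phi> ` (I \<cdot>\<^bsub>L\<^esub> J) = \<phi> ` I \<cdot>\<^bsub>K\<^esub> \<phi> ` J"
proof -
  show IJ: "I \<cdot>\<^bsub>L\<^esub> J \<subseteq> T"
    using assms by (intro L.prod_least T_closed(4,5)) auto
  show "\<phi> ` (I \<cdot>\<^bsub>L\<^esub> J) = \<phi> ` I \<cdot>\<^bsub>K\<^esub> \<phi> ` J"
  proof
    have "I \<cdot>\<^bsub>L\<^esub> J \<subseteq> {t \<in> T. \<phi> t \<in> \<phi> ` I \<cdot>\<^bsub>K\<^esub> \<phi> ` J}"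
    proof (rule L.prod_least)
      fix i j assume ij: "i \<in> I" "j \<in> J"
      then have "i \<in> T" "j \<in> T" using assms by auto
      then show "i \<otimes>\<^bsub>L\<^esub> j \<in> {t \<in> T. \<phi> t \<in> \<phi> ` I \<cdot>\<^bsub>K\<^esub> \<phi> ` J}"
        using ij T_closed(4) by (simp add: phi_mult ideal_prod.prod)
    qed (simp add: phi_add T_closed(5) ideal_prod.sum)
    then show "\<phi> ` (I \<cdot>\<^bsub>L\<^esub> J) \<subseteq> \<phi> ` I \<cdot>\<^bsub>K\<^esub> \<phi> ` J" by blast
    show "\<phi> ` I \<cdot>\<^bsub>K\<^esub> \<phi> ` J \<subseteq> \<phi> ` (I \<cdot>\<^bsub>L\<^esub> J)"
    proof (rule K.prod_least)
      fix x y assume "x \<in> \<phi> ` I" "y \<in> \<phi> ` J"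
      then obtain i j where "i \<in> I" "j \<in> J" "x = \<phi> i" "y = \<phi> j" by blast
      then show "x \<otimes>\<^bsub>K\<^esub> y \<in> \<phi> ` (I \<cdot>\<^bsub>L\<^esub> J)"
        using assms by (auto simp: phi_mult[symmetric] subset_iff intro: ideal_prod.prod)
    next
      fix x y assume "x \<in> \<phi> ` (I \<cdot>\<^bsub>L\<^esub> J)" "y \<in> \<phi> ` (I \<cdot>\<^bsub>L\<^esub> J)"
      then obtain i j where ij: "i \<in> I \<cdot>\<^bsub>L\<^esub> J" "j \<in> I \<cdot>\<^bsub>L\<^esub> J" "x = \<phi> i" "y = \<phi> j" by blast
      moreover have "i \<in> T" "j \<in> T" using ij IJ by auto
      ultimately have "x \<oplus>\<^bsub>K\<^esub> y = \<phi> (i \<oplus>\<^bsub>L\<^esub> j)" by (simp add: phi_add)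
      then show "x \<oplus>\<^bsub>K\<^esub> y \<in> \<phi> ` (I \<cdot>\<^bsub>L\<^esub> J)" using ij by (simp add: ideal_prod.sum)
    qed
  qed
qed

lemma preimage_image:
  assumes "submod L (preimage D) I" "M \<subseteq> I" "I \<subseteq> T"
  shows "preimage (\<phi> ` I) = I"
proof
  show "I \<subseteq> preimage (\<phi> ` I)" using assms unfolding preimage_def by blast
  show "preimage (\<phi> ` I) \<subseteq> I"
  proof
    fix t assume "t \<in> preimage (\<phi> ` I)"
    then obtain i where t: "t \<in> T" and i: "i \<in> I" "\<phi> t = \<phi> i" unfolding preimage_def by blast
    have iT: "i \<in> T" using i assms by blast
    have "t \<oplus>\<^bsub>L\<^esub> \<ominus>\<^bsub>L\<^esub> i \<in> M"
      using t i iT T_closed phi_carrier unfolding preimage_def by (simp add: phi_simps K.r_neg)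
    then have "i \<oplus>\<^bsub>L\<^esub> (t \<oplus>\<^bsub>L\<^esub> \<ominus>\<^bsub>L\<^esub> i) \<in> I" using assms(2) i submodD(3)[OF assms(1)] by blast
    moreover have "i \<oplus>\<^bsub>L\<^esub> (t \<oplus>\<^bsub>L\<^esub> \<ominus>\<^bsub>L\<^esub> i) = t"
      using T_carrier[OF t] T_carrier[OF iT] by (subst L.a_lcomm) (simp_all add: L.r_neg)
    ultimately show "t \<in> I" by simp
  qed
qed

lemma submod_image:
  assumes "submod L (preimage D) I" "I \<subseteq> T"
  shows "submod K D (\<phi> ` I)"
proof -
  note I = submodD[OF assms(1)]
  show ?thesis
  proof (rule K.submodI)
    show "\<phi> ` I \<subseteq> carrier K" using assms phi_carrier by blast
    show "\<zero>\<^bsub>K\<^esub> \<in> \<phi> ` I" using I(2) phi_zero by force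
    show "x \<oplus>\<^bsub>K\<^esub> y \<in> \<phi> ` I" if xy: "x \<in> \<phi> ` I" "y \<in> \<phi> ` I" for x y
    proof -
      obtain i j where "i \<in> I" "j \<in> I" "x = \<phi> i" "y = \<phi> j" using xy by blast
      then show ?thesis using I(3)[of i j] phi_add[of i j] assms(2)
        by (metis imageI subsetD)
    qed
    show "\<ominus>\<^bsub>K\<^esub> x \<in> \<phi> ` I" if x: "x \<in> \<phi> ` I" for x
    proof -
      obtain i where "i \<in> I" "x = \<phi> i" using x by blast
      then show ?thesis using I(4)[of i] phi_minus[of i] assms(2) by (metis imageI subsetD)
    qed
    show "d \<otimes>\<^bsub>K\<^esub> x \<in> \<phi> ` I" if d: "d \<in> D" and x: "x \<in> \<phi> ` I" for d x
    proof -
      obtain i where i: "i \<in> I" "x = \<phi> i" using x by blast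
      obtain r where r: "r \<in> T" "\<phi> r = d" using lift d K.A_carrier by blast
      then have "r \<in> preimage D" using d unfolding preimage_def by simp
      then show ?thesis using i r I(5)[of r i] phi_mult[of r i] assms(2) by (metis imageI subsetD)
    qed
  qed
qed

text \<open>
  Both sides contain \<open>M\<close> and have the same image in \<open>K\<close>. Without the nonzero element \<open>i\<close> this can
  fail: for \<open>I = J = 0\<close> it would say \<open>M M = M\<close>.
\<close>

lemma preimage_prod:
  assumes I: "submod K D I" and J: "submod K D J" and i: "i \<in> I" "i \<noteq> \<zero>\<^bsub>K\<^esub>"
  shows "preimage I \<cdot>\<^bsub>L\<^esub> preimage J = preimage (I \<cdot>\<^bsub>K\<^esub> J)"
proof -
  have "i \<in> carrier K" using i submodD(1)[OF I] by blast
  then obtain a where a: "a \<in> T" "\<phi> a = i" using lift by blast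
  have "M \<subseteq> preimage I \<cdot>\<^bsub>L\<^esub> preimage J"
    using a i by (intro M_absorbed[of a] M_subset_preimage I J) (auto simp: preimage_def)
  then have "preimage I \<cdot>\<^bsub>L\<^esub> preimage J = preimage (\<phi> ` (preimage I \<cdot>\<^bsub>L\<^esub> preimage J))"
    by (intro preimage_image[symmetric] L.submod_prod submod_preimage I J image_prod preimage_subset preimage_subset_carrier)
  then show ?thesis
    using submodD(1)[OF I] submodD(1)[OF J] by (simp add: image_prod preimage_subset image_preimage)
qed

lemma preimage_fractional_ideal:
  assumes "J \<in> nonzero_fractional_ideals K D"
  shows "preimage J \<in> nonzero_fractional_ideals L (preimage D)"
proof -
  note J = K.fractional_idealD[OF assms]
  obtain d j where d: "d \<in> D" "d \<noteq> \<zero>\<^bsub>K\<^esub>" "\<forall>x\<in>J. d \<otimes>\<^bsub>K\<^esub> x \<in> D" and j: "j \<in> J" "j \<noteq> \<zero>\<^bsub>K\<^esub>"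
    using J by blast
  obtain s where s: "s \<in> T" "\<phi> s = d" using lift d K.A_carrier by blast
  obtain i where i: "i \<in> T" "\<phi> i = j" using lift j J by blast
  show ?thesis
  proof (rule pullback.fractional_idealI)
    show "submod L (preimage D) (preimage J)" using submod_preimage J by blast
    show "s \<in> carrier L" "s \<noteq> \<zero>\<^bsub>L\<^esub>" "i \<noteq> \<zero>\<^bsub>L\<^esub>" "i \<in> preimage J"
      using s d i j T_carrier unfolding preimage_def by (auto simp: phi_zero)
    show "s \<otimes>\<^bsub>L\<^esub> x \<in> preimage D" if "x \<in> preimage J" for x
      using that s d T_closed unfolding preimage_def by (auto simp: phi_mult)
  qed
qed

text \<open>
  Scaling to \<open>1 \<in> J1\<close> gives \<open>1 \<in> I\<close> and hence \<open>I' = 1 1 I' \<subseteq> I I I' = I\<close>. This puts \<open>I'\<close> inside \<open>T\<close>,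
  where \<open>\<phi>\<close> can be applied, and makes its image a fractional ideal.
\<close>

theorem clifford_regular_residue:
  assumes "clifford_regular L (preimage D)"
  shows "clifford_regular K D"
  unfolding K.clifford_regular_iff
proof
  fix J assume J: "J \<in> nonzero_fractional_ideals K D"
  obtain j where j: "j \<in> J" "j \<noteq> \<zero>\<^bsub>K\<^esub>" using K.fractional_idealD(4)[OF J] by blast
  have Jc: "J \<subseteq> carrier K" using K.fractional_idealD(2)[OF J] .
  note ij = K.nonzero_inv[OF subsetD[OF Jc j(1)] j(2)]
  define J1 where "J1 = inv\<^bsub>K\<^esub> j <#\<^bsub>K\<^esub> J"
  have J1: "J1 \<in> nonzero_fractional_ideals K D"
    unfolding J1_def using J ij by (intro K.fractional_ideal_l_coset)
  note J1' = K.fractional_idealD[OF J1]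
  have one: "\<one>\<^bsub>K\<^esub> \<in> J1" unfolding J1_def mem_l_coset using ij j by (intro bexI[of _ j]) auto
  define I where "I = preimage J1"
  obtain I' where I': "I' \<in> nonzero_fractional_ideals L (preimage D)" "I \<cdot>\<^bsub>L\<^esub> I \<cdot>\<^bsub>L\<^esub> I' = I"
    using assms preimage_fractional_ideal[OF J1] unfolding pullback.clifford_regular_iff pullback.vn_regular_def I_def by blast
  have oneI: "\<one>\<^bsub>L\<^esub> \<in> I" unfolding I_def preimage_def using one T_closed by (simp add: phi_one)
  have "I' \<subseteq> I"
  proof
    fix y assume y: "y \<in> I'"
    then have "\<one>\<^bsub>L\<^esub> \<otimes>\<^bsub>L\<^esub> \<one>\<^bsub>L\<^esub> \<otimes>\<^bsub>L\<^esub> y \<in> I \<cdot>\<^bsub>L\<^esub> I \<cdot>\<^bsub>L\<^esub> I'" using oneI by (intro ideal_prod.prod)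
    then show "y \<in> I" using I' y pullback.fractional_idealD(2)[OF I'(1)] by (auto simp: subset_iff)
  qed
  then have IT: "I \<subseteq> T" "I' \<subseteq> T" "\<phi> ` I' \<subseteq> J1" unfolding I_def preimage_def by auto
  have phiI: "\<phi> ` I = J1" unfolding I_def using image_preimage J1' by blast
  have eq: "J1 \<cdot>\<^bsub>K\<^esub> J1 \<cdot>\<^bsub>K\<^esub> \<phi> ` I' = J1"
    using image_prod(2)[of "I \<cdot>\<^bsub>L\<^esub> I" I'] image_prod[of I I] IT I'(2) phiI by simp
  have "\<exists>x\<in>\<phi> ` I'. x \<noteq> \<zero>\<^bsub>K\<^esub>"
  proof (rule ccontr)
    assume "\<not> ?thesis"
    moreover have "J1 \<cdot>\<^bsub>K\<^esub> J1 \<subseteq> carrier K" using K.prod_in_carrier J1' by blast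
    ultimately have "J1 \<cdot>\<^bsub>K\<^esub> J1 \<cdot>\<^bsub>K\<^esub> \<phi> ` I' \<subseteq> {\<zero>\<^bsub>K\<^esub>}"
      by (intro K.prod_least) (auto simp: subset_iff)
    then show False using eq one by auto
  qed
  then obtain x where x: "x \<in> \<phi> ` I'" "x \<noteq> \<zero>\<^bsub>K\<^esub>" by blast
  obtain d where d: "d \<in> D" "d \<noteq> \<zero>\<^bsub>K\<^esub>" "\<forall>x\<in>J1. d \<otimes>\<^bsub>K\<^esub> x \<in> D" using J1' by blast
  have "\<phi> ` I' \<in> nonzero_fractional_ideals K D"
    using d IT K.A_carrier
    by (intro K.fractional_idealI[OF _ _ d(2) _ x] submod_image pullback.fractional_idealD(1)[OF I'(1)]) auto
  then have "K.vn_regular J1" unfolding K.vn_regular_def using eq by blast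
  then show "K.vn_regular J" unfolding J1_def using K.vn_regular_l_coset[OF Jc ij(1,2)] by blast
qed

text \<open>
  Such an ideal is the preimage of its image \<open>J\<close> in \<open>K\<close>, so an inverse of \<open>J\<close> lifts to an inverse of
  \<open>I\<close>. The case \<open>J = K\<close>, where \<open>I = T\<close>, is separate, since \<open>K\<close> is not a fractional ideal of \<open>D\<close>.
\<close>

lemma vn_regular_between:
  assumes I: "I \<in> nonzero_fractional_ideals L (preimage D)" and IT: "M \<subseteq> I" "I \<subseteq> T" "\<not> I \<subseteq> M"
    and D: "clifford_regular K D" "conducive K D" "D \<noteq> carrier K"
  shows "pullback.vn_regular I"
proof -
  note I' = pullback.fractional_idealD[OF I]
  define J where "J = \<phi> ` I"
  have J: "submod K D J" unfolding J_def using submod_image I' IT by blast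
  have I_eq: "preimage J = I" unfolding J_def using preimage_image I' IT by blast
  have Jc: "J \<subseteq> carrier K" using submodD(1)[OF J] .
  obtain j where j: "j \<in> J" "j \<noteq> \<zero>\<^bsub>K\<^esub>" using IT unfolding J_def preimage_def by blast
  have "\<exists>J'. submod K D J' \<and> preimage J' \<in> nonzero_fractional_ideals L (preimage D) \<and> J \<cdot>\<^bsub>K\<^esub> J \<cdot>\<^bsub>K\<^esub> J' = J"
  proof (cases "J = carrier K")
    case True
    have "carrier K \<subseteq> carrier K \<cdot>\<^bsub>K\<^esub> carrier K \<cdot>\<^bsub>K\<^esub> carrier K"
    proof
      fix x assume "x \<in> carrier K"
      then have "\<one>\<^bsub>K\<^esub> \<otimes>\<^bsub>K\<^esub> \<one>\<^bsub>K\<^esub> \<otimes>\<^bsub>K\<^esub> x \<in> carrier K \<cdot>\<^bsub>K\<^esub> carrier K \<cdot>\<^bsub>K\<^esub> carrier K"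
        by (intro ideal_prod.prod) auto
      then show "x \<in> carrier K \<cdot>\<^bsub>K\<^esub> carrier K \<cdot>\<^bsub>K\<^esub> carrier K" using \<open>x \<in> carrier K\<close> by simp
    qed
    then have "J \<cdot>\<^bsub>K\<^esub> J \<cdot>\<^bsub>K\<^esub> J = J"
      unfolding True by (intro equalityI K.prod_in_carrier) auto
    then show ?thesis using J I I_eq by blast
  next
    case False
    obtain d where "d \<in> carrier K" "d \<noteq> \<zero>\<^bsub>K\<^esub>" "\<And>x. x \<in> J \<Longrightarrow> d \<otimes>\<^bsub>K\<^esub> x \<in> D"
      using K.conducive_submod_denominator[OF D(2,3) J False] by blast
    then have "J \<in> nonzero_fractional_ideals K D" using j by (intro K.fractional_idealI[OF J])
    then obtain J' where "J' \<in> nonzero_fractional_ideals K D" "J \<cdot>\<^bsub>K\<^esub> J \<cdot>\<^bsub>K\<^esub> J' = J"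
      using D(1) unfolding K.clifford_regular_iff K.vn_regular_def by blast
    then show ?thesis using preimage_fractional_ideal K.fractional_idealD(1) by blast
  qed
  then obtain J' where J': "submod K D J'" "preimage J' \<in> nonzero_fractional_ideals L (preimage D)"
    "J \<cdot>\<^bsub>K\<^esub> J \<cdot>\<^bsub>K\<^esub> J' = J" by blast
  have "j \<otimes>\<^bsub>K\<^esub> j \<in> J \<cdot>\<^bsub>K\<^esub> J" using j by (intro ideal_prod.prod)
  moreover have "j \<otimes>\<^bsub>K\<^esub> j \<noteq> \<zero>\<^bsub>K\<^esub>" using j Jc by (auto simp: K.integral_iff subset_iff)
  ultimately have "preimage J \<cdot>\<^bsub>L\<^esub> preimage J \<cdot>\<^bsub>L\<^esub> preimage J' = preimage (J \<cdot>\<^bsub>K\<^esub> J \<cdot>\<^bsub>K\<^esub> J')"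
    using J J' j K.A_carrier by (simp add: preimage_prod K.submod_prod)
  then show ?thesis unfolding pullback.vn_regular_def using J' I_eq by metis
qed

lemma vn_regular_if_scaled_between:
  assumes I: "I \<in> nonzero_fractional_ideals L (preimage D)" and z: "z \<in> carrier L" "z \<noteq> \<zero>\<^bsub>L\<^esub>"
    and IT: "M \<subseteq> z <#\<^bsub>L\<^esub> I" "z <#\<^bsub>L\<^esub> I \<subseteq> T" "\<not> z <#\<^bsub>L\<^esub> I \<subseteq> M"
    and D: "clifford_regular K D" "conducive K D" "D \<noteq> carrier K"
  shows "pullback.vn_regular I"
  using pullback.vn_regular_l_coset[OF pullback.fractional_idealD(2)[OF I] z]
    vn_regular_between[OF pullback.fractional_ideal_l_coset[OF I z] IT D] by blast

text \<open>
  A valuation domain is local, so units modulo \<open>M\<close> are units. Concretely, let \<open>s = u w\<close> with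
  \<open>\<phi> s = 1\<close>, and let \<open>x = 1 / s - 1\<close>. If \<open>x \<in> T\<close>, then \<open>1 / s \<in> T\<close>. Otherwise \<open>1 / x \<in> T\<close>, and
  \<open>s = (1 / x) (1 - s)\<close> yields \<open>\<phi> s = 0\<close>.
\<close>

lemma valuation_inv_closed:
  assumes val: "valuation_domain L T" and u: "u \<in> T" "\<phi> u \<noteq> \<zero>\<^bsub>K\<^esub>"
  shows "inv\<^bsub>L\<^esub> u \<in> T"
proof -
  note ik = K.nonzero_inv[OF phi_carrier[OF u(1)] u(2)]
  obtain w where w: "w \<in> T" "\<phi> w = inv\<^bsub>K\<^esub> (\<phi> u)" using lift ik(1) by blast
  define s where "s = u \<otimes>\<^bsub>L\<^esub> w"
  have s: "s \<in> T" "\<phi> s = \<one>\<^bsub>K\<^esub>" unfolding s_def using u w T_closed ik by (auto simp: phi_mult)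
  have s0: "s \<noteq> \<zero>\<^bsub>L\<^esub>" using s(2) phi_zero by auto
  note sc = T_carrier[OF s(1)]
  note invs = L.nonzero_inv[OF sc s0]
  define x where "x = inv\<^bsub>L\<^esub> s \<oplus>\<^bsub>L\<^esub> \<ominus>\<^bsub>L\<^esub> \<one>\<^bsub>L\<^esub>"
  have xc: "x \<in> carrier L" unfolding x_def using invs by simp
  have xs: "x \<otimes>\<^bsub>L\<^esub> s = \<one>\<^bsub>L\<^esub> \<oplus>\<^bsub>L\<^esub> \<ominus>\<^bsub>L\<^esub> s"
    unfolding x_def using invs sc by (simp add: L.l_distr L.l_minus)
  have "x \<in> T"
  proof (rule ccontr)
    assume xT: "x \<notin> T"
    then have x0: "x \<noteq> \<zero>\<^bsub>L\<^esub>" using T_closed by auto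
    then have ix: "inv\<^bsub>L\<^esub> x \<in> T"
      using val xT xc unfolding valuation_domain_def T_fractions by blast
    have "s = inv\<^bsub>L\<^esub> x \<otimes>\<^bsub>L\<^esub> (\<one>\<^bsub>L\<^esub> \<oplus>\<^bsub>L\<^esub> \<ominus>\<^bsub>L\<^esub> s)"
      unfolding xs[symmetric] using xc x0 sc by (simp add: L.inv_cancel)
    then have "\<phi> s = \<phi> (inv\<^bsub>L\<^esub> x \<otimes>\<^bsub>L\<^esub> (\<one>\<^bsub>L\<^esub> \<oplus>\<^bsub>L\<^esub> \<ominus>\<^bsub>L\<^esub> s))" by simp
    also have "\<dots> = \<zero>\<^bsub>K\<^esub>"
      using ix s T_closed phi_carrier[OF ix] by (simp add: phi_simps K.r_neg)
    finally show False using s by simp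
  qed
  moreover have "inv\<^bsub>L\<^esub> s = x \<oplus>\<^bsub>L\<^esub> \<one>\<^bsub>L\<^esub>"
    unfolding x_def using invs by (simp add: L.a_assoc L.l_neg)
  ultimately have "inv\<^bsub>L\<^esub> s \<in> T" using T_closed by simp
  moreover have "inv\<^bsub>L\<^esub> u = w \<otimes>\<^bsub>L\<^esub> inv\<^bsub>L\<^esub> s"
    using T_carrier u w invs unfolding s_def
    by (intro L.comm_inv_char) (auto simp: L.m_assoc[symmetric])
  ultimately show ?thesis using w T_closed by simp
qed

text \<open>
  Let \<open>I\<close> not be a \<open>T\<close>-module, and scale it so that \<open>1 \<in> I0\<close> and \<open>v \<notin> I0\<close> for some \<open>v \<in> T\<close>. Then
  \<open>I0 \<subseteq> T\<close>: for \<open>y \<in> I0 - T\<close> the inverse of \<open>y\<close> would be a nonunit of \<open>T\<close>, hence in \<open>M\<close>, so that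
  \<open>v / y\<close> would be in the pullback and \<open>v = (v / y) y\<close> in \<open>I0\<close>.
\<close>

theorem clifford_regular_valuation:
  assumes val: "valuation_domain L T"
    and D: "clifford_regular K D" "conducive K D" "D \<noteq> carrier K"
  shows "clifford_regular L (preimage D)"
  unfolding pullback.clifford_regular_iff
proof
  fix I assume I: "I \<in> nonzero_fractional_ideals L (preimage D)"
  note I' = pullback.fractional_idealD[OF I]
  note S = submodD[OF I'(1)]
  have V: "x \<in> T \<or> inv\<^bsub>L\<^esub> x \<in> T" if "x \<in> carrier L" "x \<noteq> \<zero>\<^bsub>L\<^esub>" for x
    using val that unfolding valuation_domain_def T_fractions by blast
  show "pullback.vn_regular I"
  proof (cases "submod L T I")
    case True
    then show ?thesis
      using pullback.valuation_vn_regular[OF I _ _ True V] T_carrier preimage_subset by blast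
  next
    case False
    then obtain v x where v: "v \<in> T" and x: "x \<in> I" and vx: "v \<otimes>\<^bsub>L\<^esub> x \<notin> I"
      using I'(1) unfolding submod_def by blast
    have c: "v \<in> carrier L" "x \<in> carrier L" using v x I' T_carrier by auto
    have x0: "x \<noteq> \<zero>\<^bsub>L\<^esub>" using vx c S(2) by auto
    note ix = L.nonzero_inv[OF c(2) x0]
    define I0 where "I0 = inv\<^bsub>L\<^esub> x <#\<^bsub>L\<^esub> I"
    have I0: "I0 \<in> nonzero_fractional_ideals L (preimage D)"
      unfolding I0_def using I ix by (intro pullback.fractional_ideal_l_coset)
    note I0' = pullback.fractional_idealD[OF I0]
    note S0 = submodD[OF I0'(1)]
    have one: "\<one>\<^bsub>L\<^esub> \<in> I0" unfolding I0_def mem_l_coset using x ix by (intro bexI[of _ x]) auto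
    have vI0: "v \<notin> I0"
    proof
      assume "v \<in> I0"
      then obtain i where "i \<in> I" "v = inv\<^bsub>L\<^esub> x \<otimes>\<^bsub>L\<^esub> i" unfolding I0_def mem_l_coset by blast
      then have "v \<otimes>\<^bsub>L\<^esub> x = i" using S(1) c ix x0 by (metis L.inv_cancel(1) L.m_comm subsetD)
      then show False using vx \<open>i \<in> I\<close> by simp
    qed
    have R_I0: "preimage D \<subseteq> I0"
      using S0(5)[OF _ one] preimage_subset_carrier by (auto simp: subset_iff)
    have "I0 \<subseteq> T"
    proof
      fix y assume y: "y \<in> I0"
      show "y \<in> T"
      proof (rule ccontr)
        assume yT: "y \<notin> T"
        have yc: "y \<in> carrier L" using y I0' by blast
        have y0: "y \<noteq> \<zero>\<^bsub>L\<^esub>" using yT T_closed by auto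
        note iy = L.nonzero_inv[OF yc y0]
        have iyT: "inv\<^bsub>L\<^esub> y \<in> T" using V yT yc y0 by blast
        have "inv\<^bsub>L\<^esub> y \<in> M"
        proof (rule ccontr)
          assume "inv\<^bsub>L\<^esub> y \<notin> M"
          then have "\<phi> (inv\<^bsub>L\<^esub> y) \<noteq> \<zero>\<^bsub>K\<^esub>" using iyT unfolding preimage_def by simp
          then have "inv\<^bsub>L\<^esub> (inv\<^bsub>L\<^esub> y) \<in> T" using valuation_inv_closed[OF val iyT] by blast
          then show False using yT yc y0 by (simp add: L.nonzero_inv_inv)
        qed
        then have "v \<otimes>\<^bsub>L\<^esub> inv\<^bsub>L\<^esub> y \<in> M"
          using v T_closed phi_carrier unfolding preimage_def by (simp add: phi_mult)
        then have "v \<otimes>\<^bsub>L\<^esub> inv\<^bsub>L\<^esub> y \<otimes>\<^bsub>L\<^esub> y \<in> I0"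
          using S0(5)[OF _ y] M_subset_preimage[OF K.subring_submod[OF K.A]] by blast
        then show False using vI0 c iy yc by (simp add: L.m_assoc)
      qed
    qed
    moreover have "M \<subseteq> I0" using R_I0 M_subset_preimage[OF K.subring_submod[OF K.A]] by blast
    moreover have "\<not> I0 \<subseteq> M" using one unfolding preimage_def by (auto simp: phi_one subset_iff)
    ultimately show ?thesis
      using vn_regular_if_scaled_between[OF I ix(1,2) _ _ _ D] unfolding I0_def by blast
  qed
qed

text \<open>
  With \<open>E = d I \<subseteq> T\<close> and \<open>T E = T f\<close>, the ideal \<open>I0 = (d / f) I\<close> satisfies \<open>T I0 = T\<close>. Writing \<open>1\<close> as
  a sum of products \<open>t x\<close> with \<open>x \<in> I0\<close> shows that each \<open>m \<in> M\<close> is a sum of products \<open>(t m) x\<close> with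
  \<open>t m\<close> in the pullback, so \<open>M \<subseteq> I0\<close>; it also shows that \<open>I0\<close> is not contained in \<open>M\<close>.
\<close>

theorem clifford_regular_principal:
  assumes pid: "\<And>I. ideal I (L\<lparr>carrier := T\<rparr>) \<Longrightarrow> \<exists>f\<in>T. I = {t \<otimes>\<^bsub>L\<^esub> f | t. t \<in> T}"
    and D: "clifford_regular K D" "conducive K D" "D \<noteq> carrier K"
  shows "clifford_regular L (preimage D)"
  unfolding pullback.clifford_regular_iff
proof
  fix I assume I: "I \<in> nonzero_fractional_ideals L (preimage D)"
  note I' = pullback.fractional_idealD[OF I]
  note S = submodD[OF I'(1)]
  obtain d i where d: "d \<in> preimage D" "d \<noteq> \<zero>\<^bsub>L\<^esub>" "\<forall>x\<in>I. d \<otimes>\<^bsub>L\<^esub> x \<in> preimage D"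
    and i: "i \<in> I" "i \<noteq> \<zero>\<^bsub>L\<^esub>" using I' by blast
  have c: "d \<in> carrier L" "i \<in> carrier L" using d(1) i(1) I' preimage_subset_carrier by auto
  define E where "E = d <#\<^bsub>L\<^esub> I"
  have ET: "E \<subseteq> T" "E \<subseteq> carrier L"
    using d(3) preimage_subset T_carrier unfolding E_def by (auto simp: mem_l_coset subset_iff)
  have Tc: "T \<subseteq> carrier L" using T_carrier by blast
  have TE: "submod L T (T \<cdot>\<^bsub>L\<^esub> E)"
  proof -
    have TE_c: "T \<cdot>\<^bsub>L\<^esub> E \<subseteq> carrier L" using L.prod_in_carrier Tc ET by blast
    have "submod L (preimage D) (T \<cdot>\<^bsub>L\<^esub> E)"
      unfolding E_def using I'(1) c preimage_subset
      by (intro L.submod_prod L.submod_l_coset submod_mono[OF L.subring_submod[OF T]] preimage_subset_carrier)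
    note TE = submodD[OF this]
    show ?thesis
    proof (rule L.submodI)
      fix t x assume t: "t \<in> T" and "x \<in> T \<cdot>\<^bsub>L\<^esub> E"
      from this(2) show "t \<otimes>\<^bsub>L\<^esub> x \<in> T \<cdot>\<^bsub>L\<^esub> E"
      proof induction
        case (prod s e)
        have "t \<otimes>\<^bsub>L\<^esub> (s \<otimes>\<^bsub>L\<^esub> e) = (t \<otimes>\<^bsub>L\<^esub> s) \<otimes>\<^bsub>L\<^esub> e"
          using t prod Tc ET by (simp add: L.m_assoc subset_iff)
        then show ?case using t prod T_closed(4) by (simp add: ideal_prod.prod)
      next
        case (sum x y)
        then have "x \<in> carrier L" "y \<in> carrier L" using TE_c by auto
        then show ?case using sum T_carrier[OF t] by (simp add: L.r_distr ideal_prod.sum)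
      qed
    qed (use TE in blast)+
  qed
  have TE_T: "T \<cdot>\<^bsub>L\<^esub> E \<subseteq> T" using ET by (intro L.prod_least T_closed(4,5)) auto
  have "ideal (T \<cdot>\<^bsub>L\<^esub> E) (L\<lparr>carrier := T\<rparr>)"
  proof -
    note TE' = submodD[OF TE]
    interpret Tr: ring "L\<lparr>carrier := T\<rparr>" by (rule L.subring_is_ring[OF T])
    have neg: "inv\<^bsub>add_monoid (L\<lparr>carrier := T\<rparr>)\<^esub> x \<in> T \<cdot>\<^bsub>L\<^esub> E" if x: "x \<in> T \<cdot>\<^bsub>L\<^esub> E" for x
    proof -
      have "x \<in> T" "\<ominus>\<^bsub>L\<^esub> x \<in> T" using x TE_T T_closed(3) by auto
      then have "\<ominus>\<^bsub>L\<lparr>carrier := T\<rparr>\<^esub> x = \<ominus>\<^bsub>L\<^esub> x"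
        using T_carrier by (intro Tr.minus_equality) (auto simp: L.l_neg)
      then show ?thesis using TE'(4)[OF x] by (simp add: a_inv_def)
    qed
    show ?thesis
    proof (rule idealI[OF Tr.ring_axioms])
      show "subgroup (T \<cdot>\<^bsub>L\<^esub> E) (add_monoid (L\<lparr>carrier := T\<rparr>))"
        by (rule subgroup.intro) (use TE' TE_T neg in auto)
      fix a x assume a: "a \<in> T \<cdot>\<^bsub>L\<^esub> E" and "x \<in> carrier (L\<lparr>carrier := T\<rparr>)"
      then have x: "x \<in> T" by simp
      show "x \<otimes>\<^bsub>L\<lparr>carrier := T\<rparr>\<^esub> a \<in> T \<cdot>\<^bsub>L\<^esub> E" using TE'(5)[OF x a] by simp
      moreover have "a \<otimes>\<^bsub>L\<^esub> x = x \<otimes>\<^bsub>L\<^esub> a" using a x TE'(1) T_carrier by (auto intro: L.m_comm)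
      ultimately show "a \<otimes>\<^bsub>L\<lparr>carrier := T\<rparr>\<^esub> x \<in> T \<cdot>\<^bsub>L\<^esub> E" by simp
    qed
  qed
  then obtain f where f: "f \<in> T" "T \<cdot>\<^bsub>L\<^esub> E = {t \<otimes>\<^bsub>L\<^esub> f | t. t \<in> T}" using pid by blast
  have E_TE: "E \<subseteq> T \<cdot>\<^bsub>L\<^esub> E"
  proof
    fix e assume e: "e \<in> E"
    then have "\<one>\<^bsub>L\<^esub> \<otimes>\<^bsub>L\<^esub> e \<in> T \<cdot>\<^bsub>L\<^esub> E" using T_closed(2) by (intro ideal_prod.prod)
    then show "e \<in> T \<cdot>\<^bsub>L\<^esub> E" using e ET by (auto simp: subset_iff)
  qed
  have fc: "f \<in> carrier L" using f T_carrier by blast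
  have f0: "f \<noteq> \<zero>\<^bsub>L\<^esub>"
  proof
    assume "f = \<zero>\<^bsub>L\<^esub>"
    then have "T \<cdot>\<^bsub>L\<^esub> E \<subseteq> {\<zero>\<^bsub>L\<^esub>}" using f T_carrier by auto
    moreover have "d \<otimes>\<^bsub>L\<^esub> i \<in> E" unfolding E_def mem_l_coset using i by blast
    ultimately show False using E_TE c d i by (auto simp: L.integral_iff)
  qed
  note invf = L.nonzero_inv[OF fc f0]
  define z where "z = inv\<^bsub>L\<^esub> f \<otimes>\<^bsub>L\<^esub> d"
  have z: "z \<in> carrier L" "z \<noteq> \<zero>\<^bsub>L\<^esub>" unfolding z_def using c invf d by (auto simp: L.integral_iff)
  define I0 where "I0 = z <#\<^bsub>L\<^esub> I"
  have I0_E: "I0 = inv\<^bsub>L\<^esub> f <#\<^bsub>L\<^esub> E"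
    unfolding I0_def z_def E_def using invf c I'(2) by (simp add: L.l_coset_l_coset)
  have I0: "submod L (preimage D) I0"
    unfolding I0_def using I'(1) z(1) preimage_subset_carrier by (rule L.submod_l_coset)
  note S0 = submodD[OF I0]
  have I0_T: "I0 \<subseteq> T"
  proof
    fix x assume "x \<in> I0"
    then obtain e where e: "e \<in> E" "x = inv\<^bsub>L\<^esub> f \<otimes>\<^bsub>L\<^esub> e" unfolding I0_E mem_l_coset by blast
    then obtain t where t: "t \<in> T" "e = t \<otimes>\<^bsub>L\<^esub> f" using E_TE f(2) by blast
    then have "e = f \<otimes>\<^bsub>L\<^esub> t" using fc T_carrier L.m_comm by simp
    then have "x = t" using e(2) t(1) fc f0 T_carrier by (simp add: L.inv_cancel)
    then show "x \<in> T" using t by simp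
  qed
  have "T \<cdot>\<^bsub>L\<^esub> I0 = inv\<^bsub>L\<^esub> f <#\<^bsub>L\<^esub> (T \<cdot>\<^bsub>L\<^esub> E)"
    using L.prod_l_coset_l_coset[of "\<one>\<^bsub>L\<^esub>" "inv\<^bsub>L\<^esub> f" T E] invf Tc ET
    by (simp add: I0_E L.one_l_coset)
  moreover have "\<one>\<^bsub>L\<^esub> \<in> inv\<^bsub>L\<^esub> f <#\<^bsub>L\<^esub> (T \<cdot>\<^bsub>L\<^esub> E)"
  proof -
    have "\<one>\<^bsub>L\<^esub> \<otimes>\<^bsub>L\<^esub> f \<in> T \<cdot>\<^bsub>L\<^esub> E" unfolding f(2) using T_closed(2) by blast
    then show ?thesis unfolding mem_l_coset using invf fc by (intro bexI[of _ f]) auto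
  qed
  ultimately have one: "\<one>\<^bsub>L\<^esub> \<in> T \<cdot>\<^bsub>L\<^esub> I0" by simp
  have M_ideal: "t \<otimes>\<^bsub>L\<^esub> m \<in> M" if "t \<in> T" "m \<in> M" for t m
    using that T_closed(4) phi_carrier unfolding preimage_def by (simp add: phi_mult)
  have "M \<subseteq> I0"
  proof
    fix m assume m: "m \<in> M"
    have mc: "m \<in> carrier L" using m preimage_subset_carrier by blast
    have "T \<cdot>\<^bsub>L\<^esub> I0 \<subseteq> {x \<in> carrier L. x \<otimes>\<^bsub>L\<^esub> m \<in> I0}"
    proof (rule L.prod_least)
      fix t x assume t: "t \<in> T" and x: "x \<in> I0"
      then have tx: "t \<in> carrier L" "x \<in> carrier L" using T_carrier S0(1) by auto
      have "t \<otimes>\<^bsub>L\<^esub> m \<in> preimage D" using M_ideal[OF t m] M_subset_preimage[OF K.subring_submod[OF K.A]] by blast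
      then have "(t \<otimes>\<^bsub>L\<^esub> m) \<otimes>\<^bsub>L\<^esub> x \<in> I0" using S0(5) x by blast
      moreover have "(t \<otimes>\<^bsub>L\<^esub> m) \<otimes>\<^bsub>L\<^esub> x = t \<otimes>\<^bsub>L\<^esub> x \<otimes>\<^bsub>L\<^esub> m" using tx mc by (simp add: L.m_ac)
      ultimately show "t \<otimes>\<^bsub>L\<^esub> x \<in> {x \<in> carrier L. x \<otimes>\<^bsub>L\<^esub> m \<in> I0}" using tx by simp
    qed (use mc S0(3) in \<open>simp add: L.l_distr\<close>)
    then have "\<one>\<^bsub>L\<^esub> \<otimes>\<^bsub>L\<^esub> m \<in> I0" using one by blast
    then show "m \<in> I0" using mc by simp
  qed
  moreover have "\<not> I0 \<subseteq> M"
  proof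
    assume "I0 \<subseteq> M"
    then have "T \<cdot>\<^bsub>L\<^esub> I0 \<subseteq> M"
      using M_ideal T_closed(5) by (intro L.prod_least) (auto simp: preimage_def phi_add)
    then have "\<one>\<^bsub>L\<^esub> \<in> M" using one by blast
    then show False by (simp add: preimage_def phi_one)
  qed
  ultimately show "pullback.vn_regular I"
    using vn_regular_if_scaled_between[OF I z _ _ _ D] I0_T unfolding I0_def by blast
qed

end

section \<open>Clifford regularity of the pullback\<close>

lemma ideal_principal_if_ring_iso:
  assumes P: "principal_domain P" and S: "ring S" and h: "h \<in> ring_iso S P" and I: "ideal I S"
  shows "\<exists>f\<in>carrier S. I = {t \<otimes>\<^bsub>S\<^esub> f | t. t \<in> carrier S}"
proof -
  interpret P: principal_domain P by (rule P)
  define g where "g = inv_into (carrier S) h"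
  have g: "g \<in> ring_iso P S" unfolding g_def using ring_iso_set_sym[OF S h] .
  then have "ring_hom_ring P S g"
    using P.ring_axioms S by (intro ring_hom_ringI2) (auto simp: ring_iso_def)
  then have "ideal {p \<in> carrier P. g p \<in> I} P" using I by (rule ring_hom_ring.ideal_vimage)
  then obtain p where p: "p \<in> carrier P" "{p \<in> carrier P. g p \<in> I} = PIdl\<^bsub>P\<^esub> p"
    using P.exists_gen by blast
  have g_surj: "g ` carrier P = carrier S" using ring_iso_memE(5)[OF g] by (simp add: bij_betw_def)
  have Ic: "I \<subseteq> carrier S" using additive_subgroup.a_subset[OF ideal.axioms(1)[OF I]] .
  have "I = g ` {p \<in> carrier P. g p \<in> I}"
  proof
    show "I \<subseteq> g ` {p \<in> carrier P. g p \<in> I}"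
    proof
      fix x assume x: "x \<in> I"
      then have "x \<in> g ` carrier P" using Ic g_surj by auto
      then show "x \<in> g ` {p \<in> carrier P. g p \<in> I}" using x by auto
    qed
  qed auto
  also have "\<dots> = (\<lambda>q. g q \<otimes>\<^bsub>S\<^esub> g p) ` carrier P"
    unfolding p(2) cgenideal_def
    using ring_iso_memE(2)[OF g _ p(1)] by (auto simp: image_iff) metis+
  also have "\<dots> = (\<lambda>t. t \<otimes>\<^bsub>S\<^esub> g p) ` carrier S"
    unfolding g_surj[symmetric] by (simp add: image_image)
  finally have "I = {t \<otimes>\<^bsub>S\<^esub> g p | t. t \<in> carrier S}" by (simp only: Setcompr_eq_image)
  moreover have "g p \<in> carrier S" using p(1) g_surj by blast
  ultimately show ?thesis by blast
qed

lemma field_if_maximal_kernel: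
  assumes "ring_hom_cring S K \<phi>" and "\<phi> ` carrier S = carrier K"
    and "maximalideal (a_kernel S K \<phi>) S"
  shows "field K"
proof -
  interpret \<phi>: ring_hom_cring S K \<phi> by (rule assms)
  have "ring_hom_ring S K \<phi>"
    by (intro ring_hom_ringI2 \<phi>.R.ring_axioms \<phi>.S.ring_axioms \<phi>.homh)
  then have iso: "(\<lambda>U. the_elem (\<phi> ` U)) \<in> ring_iso (S Quot a_kernel S K \<phi>) K"
    using assms(2) by (rule ring_hom_ring.FactRing_iso_set)
  have quot: "field (S Quot a_kernel S K \<phi>)"
    using maximalideal.quotient_is_field[OF assms(3)] \<phi>.R.is_cring by blast
  have "the_elem (\<phi> ` \<zero>\<^bsub>S Quot a_kernel S K \<phi>\<^esub>) = \<zero>\<^bsub>K\<^esub>"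
    using ring_hom_zero[OF _ field.is_ring[OF quot] \<phi>.S.ring_axioms] iso
    by (auto simp: ring_iso_def)
  then show ?thesis
    using field.ring_iso_imp_img_field[OF quot iso] by simp
qed

theorem theorem5p6:
  fixes L :: "('a, 'm) ring_scheme" and K :: "('b, 'n) ring_scheme"
    and T M R :: "'a set" and D :: "'b set" and \<phi> :: "'a \<Rightarrow> 'b"
  assumes "field L" and "subring T L" and "quotient_field L T = carrier L"
    and "maximalideal M (L\<lparr>carrier := T\<rparr>)"
    and "ring_hom_cring (L\<lparr>carrier := T\<rparr>) K \<phi>"
    and "\<phi> ` T = carrier K"
    and "a_kernel (L\<lparr>carrier := T\<rparr>) K \<phi> = M"
    and "subring D K" and "D \<noteq> carrier K"
    and "R = {t \<in> T. \<phi> t \<in> D}"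
    and "quotient_field K D = carrier K"
    and "semilocal (K\<lparr>carrier := D\<rparr>)"
    and "conducive K D"
    and "valuation_domain L T \<or>
         (\<exists>h \<in> ring_iso (L\<lparr>carrier := T\<rparr>) (poly_ring K).
            h ` M = PIdl\<^bsub>poly_ring K\<^esub> X\<^bsub>K\<^esub> \<and>
            (\<forall>t\<in>T. \<phi> t = ring.eval K (h t) \<zero>\<^bsub>K\<^esub>))"
  shows "clifford_regular L R \<longleftrightarrow> clifford_regular K D"
proof -
  have K: "field K"
    using field_if_maximal_kernel[OF assms(5)] assms(4,6,7) by simp
  interpret K: field K by (rule K)
  interpret residue_pullback L K D T \<phi>
    using assms(1,2,3,6,8,11) K ring_hom_cring.homh[OF assms(5)]
    by (intro residue_pullback.intro fraction_field.intro fraction_field_axioms.intro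
        residue_pullback_axioms.intro)
  have R: "R = preimage D" using assms(10) by (simp add: preimage_def)
  have "clifford_regular L (preimage D)" if D: "clifford_regular K D"
    using assms(14)
  proof
    assume "valuation_domain L T"
    then show ?thesis using clifford_regular_valuation D assms(9,13) by blast
  next
    assume "\<exists>h \<in> ring_iso (L\<lparr>carrier := T\<rparr>) (poly_ring K).
            h ` M = PIdl\<^bsub>poly_ring K\<^esub> X\<^bsub>K\<^esub> \<and>
            (\<forall>t\<in>T. \<phi> t = ring.eval K (h t) \<zero>\<^bsub>K\<^esub>)"
    then obtain h where h: "h \<in> ring_iso (L\<lparr>carrier := T\<rparr>) (poly_ring K)" by blast
    have "principal_domain (poly_ring K)"
      using K.univ_poly_is_principal[OF K.carrier_is_subfield] .
    then show ?thesis
      using ideal_principal_if_ring_iso[OF _ L.subring_is_ring[OF T] h]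
      by (intro clifford_regular_principal D assms(9,13)) auto
  qed
  then show ?thesis unfolding R using clifford_regular_residue by blast
qed

end
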